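(* Let $r\geqslant 2$ be a fixed integer and let $\mathcal F$ be the class of evolution equations $$u_t+uu_x=\sum_{j=2}^{r}A^j(x)u_j+A^0(x)u+B(x),$$ whose arbitrary elements $\theta=(A^0,A^2,\dots,A^r,B)$ run through the smooth functions of $x$ with $A^r\neq 0$. The usual equivalence group $G^\sim_{\mathcal F}$ of the class $\mathcal F$ is four-dimensional and consists of the transformations of the form $$\tilde t=c_1t+c_2,\quad \tilde x=c_3x+c_4,\quad \tilde u=\frac{c_3}{c_1}u,\quad \tilde A^j=\frac{c_3^{\,j}}{c_1}A^j,\quad \tilde A^0=\frac1{c_1}A^0,\quad \tilde B=\frac{c_3}{c_1^2}B,$$ where $j=2,\dots,r$, and $c_1,c_2,c_3,c_4$ are arbitrary constants with $c_1c_3\neq 0$.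
   Context: Here $u=u(t,x)$ and $u_k=\partial^k u/\partial x^k$. Point transformations are (local) diffeomorphisms. A usual equivalence transformation of a class of differential equations $\{\mathcal L_\theta:\theta\in\mathcal S\}$ is a point transformation in the joint space of independent variables, dependent variable, its derivatives up to order $r$ and arbitrary elements that (i) is projectable to the space of the independent variables, $u$ and its derivatives of order up to $r'$ for each $r'=0,\dots,r$ (in particular, the $(t,x,u)$-components do not depend on the arbitrary elements), (ii) respects the contact structure (derivatives transform by prolongation), and (iii) maps every equation of the class to an equation of the same class. The usual equivalence group is the (pseudo)group of all usual equivalence transformations.
   Formalization: Point transformations are taken on nonempty connected open domains of the joint space that contain, over each occurring value of (t,x,u) and the arbitrary elements, a jet satisfying the equation; on domains missing the equation the claim fails. *)

theory Defs
  imports "HOL-Analysis.Analysis"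
begin

section \<open>Smooth maps and local diffeomorphisms\<close>

text \<open>Only used for open \<open>S\<close>.\<close>

primrec Ck_on :: "nat \<Rightarrow> 'a::euclidean_space set \<Rightarrow> ('a \<Rightarrow> 'b::euclidean_space) \<Rightarrow> bool" where
  "Ck_on 0 S f \<longleftrightarrow> continuous_on S f"
| "Ck_on (Suc k) S f \<longleftrightarrow>
     (\<forall>x\<in>S. f differentiable (at x)) \<and> (\<forall>v. Ck_on k S (\<lambda>x. frechet_derivative f (at x) v))"

definition smooth_on :: "'a::euclidean_space set \<Rightarrow> ('a \<Rightarrow> 'b::euclidean_space) \<Rightarrow> bool" where
  "smooth_on S f \<longleftrightarrow> (\<forall>k. Ck_on k S f)"

definition local_diffeo :: "'a::euclidean_space set \<Rightarrow> ('a \<Rightarrow> 'a) \<Rightarrow> bool" where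
  "local_diffeo D \<Phi> \<longleftrightarrow> open D \<and> smooth_on D \<Phi> \<and> inj_on \<Phi> D \<and>
     open (\<Phi> ` D) \<and> smooth_on (\<Phi> ` D) (inv_into D \<Phi>)"


section \<open>The joint space of variables, derivatives and arbitrary elements\<close>

text \<open>
  The order \<open>r\<close> of the equations is \<open>CARD('r)\<close>; nothing else about the type \<open>'r\<close> is used. In this
  way the jet space of order \<open>r\<close> and the joint space are Euclidean spaces.
  The pair \<open>(i, k)\<close> indexes the derivative of \<open>u\<close> taken \<open>i\<close> times in \<open>t\<close> and \<open>k\<close> times in \<open>x\<close>;
  \<open>(0, 0)\<close> is \<open>u\<close> itself.
\<close>

typedef ('r::finite) jet_index = "{(i::nat, k::nat). i + k \<le> CARD('r)}"
  by (rule exI[of _ "(0, 0)"]) simp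

instance jet_index :: (finite) finite
proof
  have "{(i::nat, k::nat). i + k \<le> CARD('a)} \<subseteq> {..CARD('a)} \<times> {..CARD('a)}"
    by auto
  then have "finite {(i::nat, k::nat). i + k \<le> CARD('a)}"
    by (rule finite_subset) simp
  then have "finite (Abs_jet_index ` {(i::nat, k::nat). i + k \<le> CARD('a)} :: 'a jet_index set)"
    by (rule finite_imageI)
  then show "finite (UNIV :: 'a jet_index set)"
    by (simp add: type_definition.Abs_image[OF type_definition_jet_index])
qed

text \<open>The index \<open>j\<close> of the coefficient \<open>A\<^sup>j\<close>; there is no \<open>A\<^sup>1\<close>.\<close>

typedef ('r::finite) coef_index = "{j::nat. j = 0 \<or> (2 \<le> j \<and> j \<le> CARD('r))}"
  by (rule exI[of _ 0]) simp

instance coef_index :: (finite) finite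
proof
  have "{j::nat. j = 0 \<or> (2 \<le> j \<and> j \<le> CARD('a))} \<subseteq> {..CARD('a)}"
    by auto
  then have "finite {j::nat. j = 0 \<or> (2 \<le> j \<and> j \<le> CARD('a))}"
    by (rule finite_subset) simp
  then have "finite (Abs_coef_index ` {j::nat. j = 0 \<or> (2 \<le> j \<and> j \<le> CARD('a))} :: 'a coef_index set)"
    by (rule finite_imageI)
  then show "finite (UNIV :: 'a coef_index set)"
    by (simp add: type_definition.Abs_image[OF type_definition_coef_index])
qed

type_synonym 'r jet = "real \<times> real \<times> (real ^ 'r jet_index)"
type_synonym 'r arb = "(real ^ 'r coef_index) \<times> real"
type_synonym 'r joint = "'r jet \<times> 'r arb"

definition tvar :: "'r::finite jet \<Rightarrow> real" where
  "tvar p = fst p"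

definition xvar :: "'r::finite jet \<Rightarrow> real" where
  "xvar p = fst (snd p)"

text \<open>\<open>der p i k\<close> is meaningful for \<open>i + k \<le> CARD('r)\<close> only, and \<open>coef \<theta> j\<close> for
  \<open>j = 0\<close> and \<open>2 \<le> j \<le> CARD('r)\<close> only.\<close>

definition der :: "'r::finite jet \<Rightarrow> nat \<Rightarrow> nat \<Rightarrow> real" where
  "der p i k = snd (snd p) $ Abs_jet_index (i, k)"

definition coef :: "'r::finite arb \<Rightarrow> nat \<Rightarrow> real" where
  "coef \<theta> j = fst \<theta> $ Abs_coef_index j"

definition inhom :: "'r::finite arb \<Rightarrow> real" where
  "inhom \<theta> = snd \<theta>"


section \<open>The class of equations\<close>

definition is_solved :: "'r::finite jet \<Rightarrow> 'r arb \<Rightarrow> bool" where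
  "is_solved p \<theta> \<longleftrightarrow>
     der p 1 0 + der p 0 0 * der p 0 1 =
       (\<Sum>j = 2..CARD('r). coef \<theta> j * der p 0 j) + coef \<theta> 0 * der p 0 0 + inhom \<theta>"

text \<open>As everything is local, a tuple of arbitrary elements is given together with the
  open interval of values of \<open>x\<close> on which it is considered.\<close>

definition arbitrary_elements :: "(real set \<times> (real \<Rightarrow> 'r::finite arb)) set" where
  "arbitrary_elements = {(I, \<theta>). open I \<and> is_interval I \<and> I \<noteq> {} \<and> smooth_on I \<theta> \<and>
     (\<forall>x\<in>I. coef (\<theta> x) (CARD('r)) \<noteq> 0)}"


section \<open>Usual equivalence transformations\<close>

text \<open>\<open>p\<close> and \<open>q\<close> have the same projection to the jet space of order \<open>s\<close>.\<close>

definition jet_agree :: "nat \<Rightarrow> 'r::finite jet \<Rightarrow> 'r jet \<Rightarrow> bool" where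
  "jet_agree s p q \<longleftrightarrow> tvar p = tvar q \<and> xvar p = xvar q \<and>
     (\<forall>i k. i + k \<le> s \<longrightarrow> der p i k = der q i k)"

definition projectable :: "'r::finite joint set \<Rightarrow> ('r joint \<Rightarrow> 'r joint) \<Rightarrow> bool" where
  "projectable D \<Phi> \<longleftrightarrow> (\<forall>s \<le> CARD('r). \<forall>z\<in>D. \<forall>w\<in>D.
     jet_agree s (fst z) (fst w) \<longrightarrow> jet_agree s (fst (\<Phi> z)) (fst (\<Phi> w)))"

text \<open>The value at \<open>p\<close> on the tangent vector \<open>v\<close> of the contact form
  \<open>du\<^bsub>ik\<^esub> - u\<^bsub>i+1,k\<^esub> dt - u\<^bsub>i,k+1\<^esub> dx\<close>, where \<open>i + k < CARD('r)\<close>.\<close>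

definition contact_form :: "nat \<Rightarrow> nat \<Rightarrow> 'r::finite jet \<Rightarrow> 'r jet \<Rightarrow> real" where
  "contact_form i k p v = der v i k - der p (Suc i) k * tvar v - der p i (Suc k) * xvar v"

definition contact_vector :: "'r::finite jet \<Rightarrow> 'r jet \<Rightarrow> bool" where
  "contact_vector p v \<longleftrightarrow> (\<forall>i k. i + k < CARD('r) \<longrightarrow> contact_form i k p v = 0)"

definition respects_contact :: "'r::finite joint set \<Rightarrow> ('r joint \<Rightarrow> 'r joint) \<Rightarrow> bool" where
  "respects_contact D \<Phi> \<longleftrightarrow> (\<forall>z\<in>D. \<forall>v. contact_vector (fst z) (fst v) \<longrightarrow>
     contact_vector (fst (\<Phi> z)) (fst (frechet_derivative \<Phi> (at z) v)))"

text \<open>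
  The arbitrary elements are regarded as functions on the jet space, so \<open>\<Phi>\<close> has to map the whole
  graph of \<open>\<theta>\<close>, and not only its part over the equation, into the graph of the new tuple \<open>\<theta>'\<close>,
  which again depends on the new \<open>x\<close> only. In addition, the equation for \<open>\<theta>\<close> has to go over
  to the equation for \<open>\<theta>'\<close>.
\<close>

definition maps_to_class_member ::
  "'r::finite joint set \<Rightarrow> ('r joint \<Rightarrow> 'r joint) \<Rightarrow>
     real set \<Rightarrow> (real \<Rightarrow> 'r arb) \<Rightarrow> real set \<Rightarrow> (real \<Rightarrow> 'r arb) \<Rightarrow> bool" where
  "maps_to_class_member D \<Phi> I \<theta> J \<theta>' \<longleftrightarrow>
     (\<forall>p q \<eta>. xvar p \<in> I \<longrightarrow> (p, \<theta> (xvar p)) \<in> D \<longrightarrow> \<Phi> (p, \<theta> (xvar p)) = (q, \<eta>) \<longrightarrow>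
        xvar q \<in> J \<and> \<eta> = \<theta>' (xvar q) \<and>
        (is_solved p (\<theta> (xvar p)) \<longleftrightarrow> is_solved q (\<theta>' (xvar q))))"

definition preserves_class :: "'r::finite joint set \<Rightarrow> ('r joint \<Rightarrow> 'r joint) \<Rightarrow> bool" where
  "preserves_class D \<Phi> \<longleftrightarrow> (\<forall>(I, \<theta>) \<in> arbitrary_elements.
     \<exists>(J, \<theta>') \<in> arbitrary_elements. maps_to_class_member D \<Phi> I \<theta> J \<theta>')"

text \<open>
  Admissible domains of transformations. The last condition is that over each value of
  \<open>(t, x, u)\<close> and of the arbitrary elements occurring in \<open>D\<close> there is a jet in \<open>D\<close> satisfying the
  corresponding equation. It holds for example for the whole joint space. It cannot be omitted:
  on a small ball such that neither it nor its image meets the hypersurface \<open>is_solved\<close>, the requirement on the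
  equations is void, and for instance \<open>(t, x, u) \<mapsto> (t, 2 x, u)\<close>, prolonged to the
  derivatives and with the values of the arbitrary elements unchanged, meets all the others.
\<close>

definition transformation_domains :: "'r::finite joint set set" where
  "transformation_domains = {D. open D \<and> connected D \<and> D \<noteq> {} \<and>
     (\<forall>(p, \<theta>) \<in> D. \<exists>q. (q, \<theta>) \<in> D \<and> jet_agree 0 p q \<and> is_solved q \<theta>)}"

definition usual_equivalence :: "'r::finite joint set \<Rightarrow> ('r joint \<Rightarrow> 'r joint) \<Rightarrow> bool" where
  "usual_equivalence D \<Phi> \<longleftrightarrow> D \<in> transformation_domains \<and> local_diffeo D \<Phi> \<and>
     projectable D \<Phi> \<and> respects_contact D \<Phi> \<and> preserves_class D \<Phi>"

text \<open>Local transformations are identified with their restrictions to their domains.\<close>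

definition usual_equivalence_group :: "('r::finite joint set \<times> ('r joint \<Rightarrow> 'r joint)) set" where
  "usual_equivalence_group = {(D, \<Phi>). usual_equivalence D \<Phi> \<and> \<Phi> \<in> extensional D}"


section \<open>Finite-dimensional groups of transformations\<close>

text \<open>
  \<open>P\<close>, an open subset of an \<open>n\<close>-dimensional space, is a Lie group with multiplication
  \<open>mul\<close> and inversion \<open>iv\<close> that acts smoothly by \<open>\<Psi>\<close>. By the last condition
  different parameter values give different transformations on each nonempty open set, so that
  all \<open>n\<close> parameters are essential; it also implies the group axioms for \<open>mul\<close> and \<open>iv\<close>.
\<close>

definition lie_transformation_group ::
  "nat \<Rightarrow> 'p::euclidean_space set \<Rightarrow> ('p \<Rightarrow> 'z::euclidean_space \<Rightarrow> 'z) \<Rightarrow> bool" where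
  "lie_transformation_group n P \<Psi> \<longleftrightarrow>
     n = DIM('p) \<and> open P \<and>
     smooth_on (P \<times> UNIV) (\<lambda>(c, z). \<Psi> c z) \<and>
     (\<exists>mul iv. \<exists>e\<in>P.
        smooth_on (P \<times> P) mul \<and> smooth_on P iv \<and> \<Psi> e = id \<and>
        (\<forall>c\<in>P. iv c \<in> P \<and> \<Psi> c \<circ> \<Psi> (iv c) = id \<and> \<Psi> (iv c) \<circ> \<Psi> c = id) \<and>
        (\<forall>c\<in>P. \<forall>d\<in>P. mul (c, d) \<in> P \<and> \<Psi> (mul (c, d)) = \<Psi> c \<circ> \<Psi> d)) \<and>
     (\<forall>c\<in>P. \<forall>d\<in>P. \<forall>W. open W \<longrightarrow> W \<noteq> {} \<longrightarrow> (\<forall>z\<in>W. \<Psi> c z = \<Psi> d z) \<longrightarrow> c = d)"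


section \<open>The explicit transformations\<close>

definition params :: "(real \<times> real \<times> real \<times> real) set" where
  "params = {(c1, c2, c3, c4). c1 * c3 \<noteq> 0}"

text \<open>The third component is \<open>u' = (c3 / c1) u\<close> for \<open>(i, k) = (0, 0)\<close> and its prolongation to
  the derivatives otherwise. The fourth one is \<open>A\<^sup>0 / c1\<close> for \<open>j = 0\<close>.\<close>

definition equiv_map :: "real \<times> real \<times> real \<times> real \<Rightarrow> 'r::finite joint \<Rightarrow> 'r joint" where
  "equiv_map = (\<lambda>(c1, c2, c3, c4) ((t, x, u), (A, B)).
     ((c1 * t + c2,
       c3 * x + c4,
       \<chi> a. (case Rep_jet_index a of (i, k) \<Rightarrow> (c3 / c1) / (c1 ^ i * c3 ^ k)) * u $ a),
      (\<chi> a. (c3 ^ Rep_coef_index a / c1) * A $ a,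
       (c3 / c1\<^sup>2) * B)))"

end

theory Submission
  imports Defs
begin

text \<open>
  Write \<open>\<Phi> (p, a) = (q, b)\<close> with \<open>p\<close> a jet and \<open>a\<close> the values of the arbitrary elements.

  The new arbitrary elements may depend on the new \<open>x\<close> only, for the images of all tuples
  \<open>a + (x - x\<^sub>0) b\<close>; as \<open>\<Phi>\<close> is a local diffeomorphism, this forces \<open>X = X(x)\<close>.
  Then, for fixed \<open>x\<close>, the map of the arbitrary elements is a local diffeomorphism that does not
  depend on \<open>p\<close> and takes the hyperplane \<open>{a. is_solved p a}\<close> into the hyperplane of \<open>q\<close>. The former
  hyperplane depends only on \<open>u\<close>, \<open>u\<^sub>j\<close> (\<open>j \<ge> 2\<close>) and \<open>u\<^sub>t + u u\<^sub>x\<close>, and the latter determines the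
  corresponding new quantities. So these are functions of the old ones and of \<open>x\<close>, which gives
  \<open>U\<^sub>t = 0\<close> at once, \<open>T = T(t)\<close> from the independence of the new \<open>u\<^sub>x\<^sub>x\<close> of \<open>u\<^sub>t\<^sub>x\<close>, \<open>U T\<^sub>t = X\<^sub>x u\<close> from
  the independence of the new \<open>u\<^sub>t + u u\<^sub>x\<close> of \<open>u\<^sub>x\<close> for fixed \<open>u\<^sub>t + u u\<^sub>x\<close>, and \<open>U\<^sub>x = 0\<close> from the same
  independence of the new \<open>u\<^sub>x\<^sub>x\<close>. Hence \<open>T\<^sub>t\<close> and \<open>X\<^sub>x\<close> are constant. The prolongation and the
  components for the arbitrary elements follow; the points with \<open>A\<^sup>r = 0\<close> are reached by continuity.
\<close>

section \<open>Smooth maps\<close>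

lemma Ck_on_cong:
  assumes "open S" "\<And>x. x \<in> S \<Longrightarrow> f x = g x" "Ck_on k S f"
  shows "Ck_on k S g"
  using assms(2,3)
proof (induction k arbitrary: f g)
  case 0
  then show ?case by (simp cong: continuous_on_cong)
next
  case (Suc k)
  have g: "(g has_derivative frechet_derivative f (at x)) (at x)" if "x \<in> S" for x
  proof (rule has_derivative_transform_within_open[OF _ assms(1) that])
    show "(f has_derivative frechet_derivative f (at x)) (at x)"
      using Suc.prems(2) that by (simp add: frechet_derivative_works)
  qed (use Suc.prems(1) in auto)
  have "frechet_derivative g (at x) = frechet_derivative f (at x)" if "x \<in> S" for x
    using frechet_derivative_at[OF g[OF that]] by simp
  then have "Ck_on k S (\<lambda>x. frechet_derivative g (at x) v)" for v
    using Suc.IH[of "\<lambda>x. frechet_derivative f (at x) v"] Suc.prems by simp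
  then show ?case
    using g by (auto simp: differentiable_def)
qed

text \<open>Allows the step to order \<open>Suc k\<close> with any known derivative
  \<open>f'\<close> in place of the \<open>frechet_derivative\<close> of the definition: the two
  agree on \<open>S\<close> by uniqueness, and \<open>Ck_on_cong\<close> exchanges them.\<close>

lemma Ck_on_SucI:
  assumes "open S" "\<And>x. x \<in> S \<Longrightarrow> (f has_derivative f' x) (at x)"
    and "\<And>v. Ck_on k S (\<lambda>x. f' x v)"
  shows "Ck_on (Suc k) S f"
proof -
  have "Ck_on k S (\<lambda>x. frechet_derivative f (at x) v)" for v
    by (rule Ck_on_cong[OF assms(1) _ assms(3)[of v]])
      (simp add: frechet_derivative_at[OF assms(2), symmetric])
  then show ?thesis
    using assms(2) by (auto simp: differentiable_def)
qed

lemma Ck_on_SucD: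
  assumes "Ck_on (Suc k) S f"
  shows "Ck_on k S f"
  using assms
proof (induction k arbitrary: f)
  case 0
  then show ?case
    by (auto intro!: continuous_at_imp_continuous_on differentiable_imp_continuous_within)
next
  case (Suc k)
  then show ?case
    by (metis Ck_on.simps(2))
qed

lemma Ck_on_Suc_has_derivative:
  "Ck_on (Suc k) S f \<Longrightarrow> x \<in> S \<Longrightarrow> (f has_derivative frechet_derivative f (at x)) (at x)"
  by (simp add: frechet_derivative_works)

lemma Ck_on_const: "Ck_on k S (\<lambda>x. c)"
  by (induction k arbitrary: c) auto

lemma Ck_on_bounded_linear:
  assumes "open S" "bounded_linear f"
  shows "Ck_on k S f"
proof (cases k)
  case 0
  then show ?thesis
    using assms(2) by (simp add: linear_continuous_on)
next
  case (Suc k)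
  then show ?thesis
    by (auto intro!: Ck_on_SucI[where f' = "\<lambda>_. f"] assms bounded_linear_imp_has_derivative
        simp: Ck_on_const simp del: Ck_on.simps)
qed

lemma Ck_on_add:
  assumes "open S" "Ck_on k S f" "Ck_on k S g"
  shows "Ck_on k S (\<lambda>x. f x + g x)"
  using assms(2,3)
proof (induction k arbitrary: f g)
  case 0
  then show ?case by (simp add: continuous_on_add)
next
  case (Suc k)
  have "((\<lambda>x. f x + g x) has_derivative
      (\<lambda>v. frechet_derivative f (at x) v + frechet_derivative g (at x) v)) (at x)"
    if "x \<in> S" for x
    by (rule has_derivative_add[OF Suc.prems[THEN Ck_on_Suc_has_derivative, OF that]])
  then show ?case
    by (rule Ck_on_SucI[OF assms(1)]) (use Suc in auto)
qed

lemma Ck_on_linear_compose: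
  assumes "open S" "bounded_linear L" "Ck_on k S f"
  shows "Ck_on k S (\<lambda>x. L (f x))"
  using assms(3)
proof (induction k arbitrary: f)
  case 0
  then show ?case by (simp add: bounded_linear.continuous_on[OF assms(2)])
next
  case (Suc k)
  have "((\<lambda>x. L (f x)) has_derivative (\<lambda>v. L (frechet_derivative f (at x) v))) (at x)"
    if "x \<in> S" for x
    by (rule bounded_linear.has_derivative[OF assms(2) Ck_on_Suc_has_derivative[OF Suc.prems that]])
  then show ?case
    by (rule Ck_on_SucI[OF assms(1)]) (use Suc in auto)
qed

text \<open>For an affine inner map the induction closes without a general chain rule: the
  derivative in direction \<open>v\<close> is a partial derivative of \<open>f\<close>, in the
  constant direction \<open>A v\<close>, composed with the same affine map.\<close>

lemma Ck_on_compose_affine: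
  assumes "open S" "bounded_linear A" "\<And>x. x \<in> S \<Longrightarrow> A x + b \<in> S'" "Ck_on k S' f"
  shows "Ck_on k S (\<lambda>x. f (A x + b))"
  using assms(4)
proof (induction k arbitrary: f)
  case 0
  have "continuous_on S (\<lambda>x. A x + b)"
    by (intro continuous_intros linear_continuous_on assms(2))
  then show ?case
    using 0 assms(3) by (auto intro: continuous_on_compose2)
next
  case (Suc k)
  have "((\<lambda>x. f (A x + b)) has_derivative (\<lambda>v. frechet_derivative f (at (A x + b)) (A v))) (at x)"
    if "x \<in> S" for x
  proof -
    have "((\<lambda>x. A x + b) has_derivative A) (at x)"
      using bounded_linear_imp_has_derivative[OF assms(2)]
      by (auto intro!: derivative_eq_intros)
    from has_derivative_compose[OF this Ck_on_Suc_has_derivative[OF Suc.prems assms(3)[OF that]]]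
    show ?thesis by (simp add: o_def)
  qed
  then show ?case
    by (rule Ck_on_SucI[OF assms(1)]) (use Suc in auto)
qed

lemma Ck_on_mult:
  fixes f g :: "'a::euclidean_space \<Rightarrow> real"
  assumes "open S" "Ck_on k S f" "Ck_on k S g"
  shows "Ck_on k S (\<lambda>x. f x * g x)"
  using assms(2,3)
proof (induction k arbitrary: f g)
  case 0
  then show ?case by (simp add: continuous_on_mult)
next
  case (Suc k)
  show ?case
  proof (rule Ck_on_SucI[OF assms(1)])
    show "((\<lambda>x. f x * g x) has_derivative
        (\<lambda>v. f x * frechet_derivative g (at x) v + frechet_derivative f (at x) v * g x)) (at x)"
      if "x \<in> S" for x
      by (rule has_derivative_mult[OF Suc.prems[THEN Ck_on_Suc_has_derivative, OF that]])
    show "Ck_on k S (\<lambda>x. f x * frechet_derivative g (at x) v + frechet_derivative f (at x) v * g x)"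
      for v
      using Suc.prems[THEN Ck_on_SucD] Suc.prems
      by (intro Ck_on_add[OF assms(1)] Suc.IH) auto
  qed
qed

text \<open>The derivative is a product of \<open>inverse (f x)\<close>, of order \<open>k\<close>
  by induction, and a derivative of \<open>f\<close>, so closure under products suffices.\<close>

lemma Ck_on_inverse:
  fixes f :: "'a::euclidean_space \<Rightarrow> real"
  assumes "open S" "\<And>x. x \<in> S \<Longrightarrow> f x \<noteq> 0" "Ck_on k S f"
  shows "Ck_on k S (\<lambda>x. inverse (f x))"
  using assms(3)
proof (induction k)
  case 0
  then show ?case using assms(2) by (simp add: continuous_on_inverse)
next
  case (Suc k)
  show ?case
  proof (rule Ck_on_SucI[OF assms(1)])
    show "((\<lambda>x. inverse (f x)) has_derivative
        (\<lambda>v. - (inverse (f x) * frechet_derivative f (at x) v * inverse (f x)))) (at x)"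
      if "x \<in> S" for x
      by (rule Deriv.has_derivative_inverse[OF assms(2)[OF that] Ck_on_Suc_has_derivative[OF Suc.prems that]])
    show "Ck_on k S (\<lambda>x. - (inverse (f x) * frechet_derivative f (at x) v * inverse (f x)))" for v
      using Suc.IH[OF Ck_on_SucD[OF Suc.prems]] Suc.prems
      by (intro Ck_on_linear_compose[OF assms(1) bounded_linear_minus[OF bounded_linear_ident]]
          Ck_on_mult[OF assms(1)]) auto
  qed
qed

section \<open>Closure properties of smooth maps\<close>

lemma smooth_on_cong:
  assumes "smooth_on S f" "open S" "\<And>x. x \<in> S \<Longrightarrow> f x = g x"
  shows "smooth_on S g"
  using assms Ck_on_cong unfolding smooth_on_def by blast

lemma smooth_on_has_derivative:
  assumes "smooth_on S f" "x \<in> S"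
  shows "(f has_derivative frechet_derivative f (at x)) (at x)"
  using assms Ck_on_Suc_has_derivative unfolding smooth_on_def by blast

lemma smooth_on_const: "smooth_on S (\<lambda>x. c)"
  by (simp add: smooth_on_def Ck_on_const)

lemma smooth_on_bounded_linear: "open S \<Longrightarrow> bounded_linear f \<Longrightarrow> smooth_on S f"
  by (simp add: smooth_on_def Ck_on_bounded_linear)

lemma smooth_on_add:
  "open S \<Longrightarrow> smooth_on S f \<Longrightarrow> smooth_on S g \<Longrightarrow> smooth_on S (\<lambda>x. f x + g x)"
  by (simp add: smooth_on_def Ck_on_add)

lemma smooth_on_linear_compose:
  "open S \<Longrightarrow> bounded_linear L \<Longrightarrow> smooth_on S f \<Longrightarrow> smooth_on S (\<lambda>x. L (f x))"
  by (simp add: smooth_on_def Ck_on_linear_compose)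

lemma smooth_on_compose_affine:
  "open S \<Longrightarrow> bounded_linear A \<Longrightarrow> (\<And>x. x \<in> S \<Longrightarrow> A x + b \<in> S') \<Longrightarrow> smooth_on S' f \<Longrightarrow>
    smooth_on S (\<lambda>x. f (A x + b))"
  unfolding smooth_on_def by (blast intro: Ck_on_compose_affine)

lemma smooth_on_mult:
  fixes f g :: "'a::euclidean_space \<Rightarrow> real"
  shows "open S \<Longrightarrow> smooth_on S f \<Longrightarrow> smooth_on S g \<Longrightarrow> smooth_on S (\<lambda>x. f x * g x)"
  by (simp add: smooth_on_def Ck_on_mult)

lemma smooth_on_divide:
  fixes f g :: "'a::euclidean_space \<Rightarrow> real"
  assumes "open S" "smooth_on S f" "smooth_on S g" "\<And>x. x \<in> S \<Longrightarrow> g x \<noteq> 0"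
  shows "smooth_on S (\<lambda>x. f x / g x)"
  unfolding divide_inverse using assms by (simp add: smooth_on_def Ck_on_mult Ck_on_inverse)

lemma smooth_on_power:
  fixes f :: "'a::euclidean_space \<Rightarrow> real"
  assumes "open S" "smooth_on S f"
  shows "smooth_on S (\<lambda>x. f x ^ n)"
  by (induction n) (simp_all add: smooth_on_const smooth_on_mult assms)

lemma smooth_on_sum:
  assumes "open S" "\<And>i. i \<in> I \<Longrightarrow> smooth_on S (f i)"
  shows "smooth_on S (\<lambda>x. \<Sum>i\<in>I. f i x)"
  using assms(2)
  by (induction I rule: infinite_finite_induct) (simp_all add: smooth_on_const smooth_on_add assms(1))

text \<open>A pair is the sum of its two coordinate embeddings, which are linear;
  \<open>smooth_on_vec_lambda\<close> treats vectors in the same way.\<close>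

lemma smooth_on_Pair:
  assumes "open S" "smooth_on S f" "smooth_on S g"
  shows "smooth_on S (\<lambda>x. (f x, g x))"
proof -
  have "smooth_on S (\<lambda>x. (f x, 0) + (0, g x))"
    by (intro smooth_on_add[OF assms(1)]
        smooth_on_linear_compose[OF assms(1) _ assms(2), of "\<lambda>y. (y, 0)"]
        smooth_on_linear_compose[OF assms(1) _ assms(3), of "\<lambda>y. (0, y)"]
        bounded_linear_Pair bounded_linear_ident bounded_linear_zero)
  then show ?thesis by simp
qed

lemma smooth_on_vec_lambda:
  fixes f :: "'n::finite \<Rightarrow> 'a::euclidean_space \<Rightarrow> real"
  assumes "open S" "\<And>i. smooth_on S (f i)"
  shows "smooth_on S (\<lambda>x. \<chi> i. f i x)"
proof -
  have "smooth_on S (\<lambda>x. \<Sum>i\<in>UNIV. f i x *\<^sub>R axis i 1)"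
    by (intro smooth_on_sum assms
        smooth_on_linear_compose[OF assms(1) bounded_linear_scaleR_left, of "f _"])
  then show ?thesis
    by (rule smooth_on_cong[OF _ assms(1)])
      (simp add: vec_eq_iff axis_def if_distrib cong: if_cong)
qed

lemma smooth_on_fst: "open S \<Longrightarrow> smooth_on S f \<Longrightarrow> smooth_on S (\<lambda>x. fst (f x))"
  by (rule smooth_on_linear_compose[OF _ bounded_linear_fst])

lemma smooth_on_snd: "open S \<Longrightarrow> smooth_on S f \<Longrightarrow> smooth_on S (\<lambda>x. snd (f x))"
  by (rule smooth_on_linear_compose[OF _ bounded_linear_snd])

lemma smooth_on_vec_nth:
  fixes f :: "'a::euclidean_space \<Rightarrow> real ^ 'n"
  shows "open S \<Longrightarrow> smooth_on S f \<Longrightarrow> smooth_on S (\<lambda>x. f x $ i)"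
  by (rule smooth_on_linear_compose[OF _ bounded_linear_vec_nth])

lemma smooth_on_id: "open S \<Longrightarrow> smooth_on S (\<lambda>x. x)"
  by (rule smooth_on_bounded_linear[OF _ bounded_linear_ident])

lemmas smooth_on_intros =
  smooth_on_const smooth_on_id smooth_on_fst smooth_on_snd smooth_on_vec_nth smooth_on_Pair
  smooth_on_vec_lambda smooth_on_add smooth_on_mult smooth_on_divide smooth_on_power

section \<open>The explicit transformations\<close>

lemma tvar_simps [simp]: "tvar (p + q) = tvar p + tvar q" "tvar (p - q) = tvar p - tvar q"
    "tvar (- p) = - tvar p" "tvar (s *\<^sub>R p) = s * tvar p" "tvar 0 = 0"
  and xvar_simps [simp]: "xvar (p + q) = xvar p + xvar q" "xvar (p - q) = xvar p - xvar q"
    "xvar (- p) = - xvar p" "xvar (s *\<^sub>R p) = s * xvar p" "xvar 0 = 0"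
  and der_simps [simp]: "der (p + q) i k = der p i k + der q i k"
    "der (p - q) i k = der p i k - der q i k" "der (- p) i k = - der p i k"
    "der (s *\<^sub>R p) i k = s * der p i k" "der 0 i k = 0"
  by (simp_all add: tvar_def xvar_def der_def)

lemma coef_simps [simp]: "coef (a + b) j = coef a j + coef b j"
    "coef (a - b) j = coef a j - coef b j"
    "coef (s *\<^sub>R a) j = s * coef a j" "coef 0 j = 0"
  and inhom_simps [simp]: "inhom (a + b) = inhom a + inhom b" "inhom (a - b) = inhom a - inhom b"
    "inhom (s *\<^sub>R a) = s * inhom a" "inhom 0 = 0"
  by (simp_all add: coef_def inhom_def)

lemma bounded_linear_tvar: "bounded_linear (tvar :: 'r::finite jet \<Rightarrow> real)"
  and bounded_linear_xvar: "bounded_linear (xvar :: 'r::finite jet \<Rightarrow> real)"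
  and bounded_linear_der: "bounded_linear (\<lambda>p :: 'r::finite jet. der p i k)"
  by (simp_all add: linear_conv_bounded_linear[symmetric] linear_iff)

lemma Rep_Abs_jet_index:
  "i + k \<le> CARD('r) \<Longrightarrow> Rep_jet_index (Abs_jet_index (i, k) :: 'r::finite jet_index) = (i, k)"
  by (simp add: Abs_jet_index_inverse)

lemma Rep_Abs_coef_index:
  "j = 0 \<or> 2 \<le> j \<and> j \<le> CARD('r) \<Longrightarrow> Rep_coef_index (Abs_coef_index j :: 'r::finite coef_index) = j"
  by (simp add: Abs_coef_index_inverse)

lemma jet_eqI:
  fixes p q :: "'r::finite jet"
  assumes "jet_agree CARD('r) p q"
  shows "p = q"
proof -
  have "snd (snd p) $ a = snd (snd q) $ a" for a
  proof (cases a)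
    case (Abs_jet_index y)
    then show ?thesis
      using assms by (cases y) (auto simp: jet_agree_def der_def)
  qed
  then show ?thesis
    using assms by (auto simp: jet_agree_def tvar_def xvar_def prod_eq_iff vec_eq_iff)
qed

lemma arb_eqI:
  fixes a b :: "'r::finite arb"
  assumes "\<And>j. j = 0 \<or> 2 \<le> j \<and> j \<le> CARD('r) \<Longrightarrow> coef a j = coef b j" "inhom a = inhom b"
  shows "a = b"
proof -
  have "fst a $ i = fst b $ i" for i
  proof (cases i)
    case (Abs_coef_index y)
    then show ?thesis
      using assms(1) by (auto simp: coef_def)
  qed
  then show ?thesis
    using assms(2) by (auto simp: inhom_def prod_eq_iff vec_eq_iff)
qed

section \<open>The parameter group\<close>

text \<open>Projections replace the pattern matching of the definition, so that
  \<open>smooth_on_intros\<close> can handle the dependence on \<open>c\<close> and \<open>z\<close>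
  jointly.\<close>

lemma equiv_map_eq:
  "equiv_map c z =
    ((fst c * fst (fst z) + fst (snd c),
      fst (snd (snd c)) * fst (snd (fst z)) + snd (snd (snd c)),
      \<chi> a. (fst (snd (snd c)) / fst c)
            / (fst c ^ fst (Rep_jet_index a) * fst (snd (snd c)) ^ snd (Rep_jet_index a))
            * snd (snd (fst z)) $ a),
     (\<chi> a. (fst (snd (snd c)) ^ Rep_coef_index a / fst c) * fst (snd z) $ a,
      (fst (snd (snd c)) / (fst c)\<^sup>2) * snd (snd z)))"
  by (cases c; cases z) (auto simp: equiv_map_def case_prod_unfold)

lemma equiv_map_simps:
  fixes z :: "'r::finite joint"
  shows "tvar (fst (equiv_map (c1, c2, c3, c4) z)) = c1 * tvar (fst z) + c2"
    and "xvar (fst (equiv_map (c1, c2, c3, c4) z)) = c3 * xvar (fst z) + c4"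
    and "i + k \<le> CARD('r) \<Longrightarrow> der (fst (equiv_map (c1, c2, c3, c4) z)) i k
      = (c3 / c1) / (c1 ^ i * c3 ^ k) * der (fst z) i k"
    and "j = 0 \<or> 2 \<le> j \<and> j \<le> CARD('r) \<Longrightarrow> coef (snd (equiv_map (c1, c2, c3, c4) z)) j
      = c3 ^ j / c1 * coef (snd z) j"
    and "inhom (snd (equiv_map (c1, c2, c3, c4) z)) = c3 / c1\<^sup>2 * inhom (snd z)"
  by (simp_all add: equiv_map_eq tvar_def xvar_def der_def coef_def inhom_def
      Rep_Abs_jet_index Rep_Abs_coef_index)

lemma joint_eqI:
  fixes z w :: "'r::finite joint"
  assumes "tvar (fst z) = tvar (fst w)" "xvar (fst z) = xvar (fst w)"
    and "\<And>i k. i + k \<le> CARD('r) \<Longrightarrow> der (fst z) i k = der (fst w) i k"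
    and "\<And>j. j = 0 \<or> 2 \<le> j \<and> j \<le> CARD('r) \<Longrightarrow> coef (snd z) j = coef (snd w) j"
    and "inhom (snd z) = inhom (snd w)"
  shows "z = w"
  using assms by (intro prod_eqI jet_eqI arb_eqI) (auto simp: jet_agree_def)

text \<open>On \<open>t\<close> and \<open>x\<close> this is the group law of two copies of the
  affine group of the line; all other factors are products of powers of \<open>c1\<close> and
  \<open>c3\<close>, hence multiplicative.\<close>

lemma equiv_map_compose:
  "equiv_map (c1, c2, c3, c4) (equiv_map (d1, d2, d3, d4) z)
    = equiv_map (c1 * d1, c1 * d2 + c2, c3 * d3, c3 * d4 + c4) z"
  by (rule joint_eqI)
    (simp_all add: equiv_map_simps algebra_simps power_mult_distrib power2_eq_square)

lemma equiv_map_identity: "equiv_map (1, 0, 1, 0) z = z"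
  by (rule joint_eqI) (simp_all add: equiv_map_simps)

lemma open_params: "open params"
proof -
  have "params = {c :: real \<times> real \<times> real \<times> real. fst c * fst (snd (snd c)) \<noteq> 0}"
    by (auto simp: params_def)
  moreover have "open {c :: real \<times> real \<times> real \<times> real. fst c * fst (snd (snd c)) \<noteq> 0}"
    by (intro open_Collect_neq continuous_intros)
  ultimately show ?thesis by simp
qed

lemma smooth_on_equiv_map: "smooth_on (params \<times> UNIV) (\<lambda>(c, z). equiv_map c z)"
proof -
  have "open (params \<times> UNIV)"
    by (intro open_Times open_params open_UNIV)
  then show ?thesis
    unfolding case_prod_unfold equiv_map_eq
    by (intro smooth_on_intros) (auto simp: params_def)
qed

text \<open>The \<open>t\<close>- and \<open>x\<close>-components determine \<open>c\<close>: two
  points of \<open>W\<close> that differ in both coordinates yield first the slopes and then the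
  shifts.\<close>

lemma equiv_map_inj:
  assumes "open W" "W \<noteq> {}" "\<forall>z\<in>W. equiv_map c z = equiv_map d z"
  shows "c = d"
proof -
  obtain c1 c2 c3 c4 d1 d2 d3 d4 where c: "c = (c1, c2, c3, c4)" and d: "d = (d1, d2, d3, d4)"
    by (metis prod.exhaust)
  obtain z where "z \<in> W" using assms(2) by auto
  then obtain e where e: "e > 0" "cball z e \<subseteq> W"
    using assms(1) open_contains_cball by blast
  define w where "w = (1 :: real, 1 :: real, 0 :: real ^ 'a jet_index)"
  \<comment> \<open>With this scaling the second point has distance exactly \<open>e\<close> from
    \<open>z\<close>, so it stays in the closed ball.\<close>
  define s where "s = e / norm (w, 0 :: 'a arb)"
  have w: "tvar w = 1" "xvar w = 1" by (simp_all add: w_def tvar_def xvar_def)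
  have "w \<noteq> 0" by (simp add: w_def zero_prod_def)
  then have s: "s > 0" "z + s *\<^sub>R (w, 0) \<in> W"
    using e by (auto simp: s_def dist_norm intro!: subsetD[OF e(2)])
  have "tvar (fst (equiv_map c z)) = tvar (fst (equiv_map d z))"
    "xvar (fst (equiv_map c z)) = xvar (fst (equiv_map d z))"
    "tvar (fst (equiv_map c (z + s *\<^sub>R (w, 0)))) = tvar (fst (equiv_map d (z + s *\<^sub>R (w, 0))))"
    "xvar (fst (equiv_map c (z + s *\<^sub>R (w, 0)))) = xvar (fst (equiv_map d (z + s *\<^sub>R (w, 0))))"
    using assms(3) s(2) \<open>z \<in> W\<close> by auto
  then have eq: "c1 * tvar (fst z) + c2 = d1 * tvar (fst z) + d2"
    "c3 * xvar (fst z) + c4 = d3 * xvar (fst z) + d4"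
    "c1 * tvar (fst z) + c1 * s + c2 = d1 * tvar (fst z) + d1 * s + d2"
    "c3 * xvar (fst z) + c3 * s + c4 = d3 * xvar (fst z) + d3 * s + d4"
    by (simp_all add: c d equiv_map_simps w distrib_left)
  have "c1 * s = d1 * s" "c3 * s = d3 * s"
    using eq by linarith+
  then show ?thesis
    using s(1) eq by (simp add: c d)
qed

lemma lie_transformation_group_equiv_map:
  "lie_transformation_group 4 params
    (equiv_map :: real \<times> real \<times> real \<times> real \<Rightarrow> 'r::finite joint \<Rightarrow> 'r joint)"
proof -
  \<comment> \<open>\<open>mul\<close> and \<open>iv\<close> are read off from
    \<open>equiv_map_compose\<close>. Negation is written as a product with \<open>- 1\<close> to
    fit \<open>smooth_on_intros\<close>.\<close>
  define mul :: "(real \<times> real \<times> real \<times> real) \<times> (real \<times> real \<times> real \<times> real) \<Rightarrow> _" where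
    "mul = (\<lambda>(c, d). (fst c * fst d, fst c * fst (snd d) + fst (snd c),
      fst (snd (snd c)) * fst (snd (snd d)),
      fst (snd (snd c)) * snd (snd (snd d)) + snd (snd (snd c))))"
  define iv :: "real \<times> real \<times> real \<times> real \<Rightarrow> _" where
    "iv = (\<lambda>c. (1 / fst c, - 1 * fst (snd c) / fst c, 1 / fst (snd (snd c)),
      - 1 * snd (snd (snd c)) / fst (snd (snd c))))"
  have "open (params \<times> params)"
    by (intro open_Times open_params)
  then have "smooth_on (params \<times> params) mul"
    unfolding mul_def case_prod_unfold by (intro smooth_on_intros)
  moreover have "smooth_on params iv"
    unfolding iv_def using open_params by (intro smooth_on_intros) (auto simp: params_def)
  moreover have "(equiv_map (1, 0, 1, 0) :: 'r joint \<Rightarrow> 'r joint) = id"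
    by (simp add: fun_eq_iff equiv_map_identity)
  moreover have "iv c \<in> params \<and> equiv_map c \<circ> equiv_map (iv c) = (id :: 'r joint \<Rightarrow> 'r joint) \<and>
      equiv_map (iv c) \<circ> equiv_map c = (id :: 'r joint \<Rightarrow> 'r joint)" if "c \<in> params" for c
    using that
    by (auto simp: params_def iv_def fun_eq_iff equiv_map_compose equiv_map_identity field_simps)
  moreover have "mul (c, d) \<in> params \<and>
      (equiv_map (mul (c, d)) :: 'r joint \<Rightarrow> 'r joint) = equiv_map c \<circ> equiv_map d"
    if "c \<in> params" "d \<in> params" for c d
    using that by (auto simp: params_def mul_def fun_eq_iff equiv_map_compose)
  moreover have "(1, 0, 1, 0) \<in> params" by (simp add: params_def)
  ultimately have "\<exists>mul iv. \<exists>e\<in>params. smooth_on (params \<times> params) mul \<and> smooth_on params iv \<and>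
      equiv_map e = (id :: 'r joint \<Rightarrow> 'r joint) \<and>
      (\<forall>c\<in>params. iv c \<in> params \<and>
        equiv_map c \<circ> equiv_map (iv c) = (id :: 'r joint \<Rightarrow> 'r joint) \<and>
        equiv_map (iv c) \<circ> equiv_map c = (id :: 'r joint \<Rightarrow> 'r joint)) \<and>
      (\<forall>c\<in>params. \<forall>d\<in>params. mul (c, d) \<in> params \<and>
        equiv_map (mul (c, d)) = equiv_map c \<circ> (equiv_map d :: 'r joint \<Rightarrow> 'r joint))"
    by blast
  moreover have "4 = DIM(real \<times> real \<times> real \<times> real)" by simp
  moreover have "\<forall>c\<in>params. \<forall>d\<in>params. \<forall>W. open W \<longrightarrow> W \<noteq> {} \<longrightarrow>
      (\<forall>z\<in>W. equiv_map c z = (equiv_map d z :: 'r joint)) \<longrightarrow> c = d"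
    using equiv_map_inj by blast
  ultimately show ?thesis
    unfolding lie_transformation_group_def using open_params smooth_on_equiv_map by blast
qed

section \<open>The explicit transformations are usual equivalence transformations\<close>

lemma linear_equiv_map: "linear (equiv_map (c1, 0, c3, 0) :: 'r::finite joint \<Rightarrow> 'r joint)"
  by (rule linearI; rule joint_eqI) (simp_all add: equiv_map_simps distrib_left add_divide_distrib)

lemma equiv_map_affine:
  "equiv_map (c1, c2, c3, c4) z = equiv_map (c1, 0, c3, 0) z + ((c2, c4, 0), 0)"
  by (rule joint_eqI) (simp_all add: equiv_map_simps, simp_all add: tvar_def xvar_def der_def coef_def inhom_def)

lemma has_derivative_equiv_map:
  "(equiv_map (c1, c2, c3, c4) has_derivative equiv_map (c1, 0, c3, 0)) (at z)"
  unfolding equiv_map_affine[abs_def, of c1 c2 c3 c4]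
  using bounded_linear_imp_has_derivative[OF linear_equiv_map[unfolded linear_conv_bounded_linear], of c1 c3]
  by (auto intro!: derivative_eq_intros)

lemma smooth_on_equiv_map_fixed:
  assumes "open D"
  shows "smooth_on D (equiv_map c)"
proof -
  obtain c1 c2 c3 c4 where c: "c = (c1, c2, c3, c4)" by (metis prod.exhaust)
  show ?thesis
    unfolding c equiv_map_affine[abs_def, of c1 c2 c3 c4]
    using assms linear_equiv_map
    by (intro smooth_on_add smooth_on_const smooth_on_bounded_linear)
      (auto simp: linear_conv_bounded_linear)
qed

text \<open>Each term of the equation, u_t, u u_x, A^j u_j, A^0 u and B, acquires the same factor c3
  / c1^2.\<close>

lemma is_solved_equiv_map:
  fixes p :: "'r::finite jet"
  assumes "CARD('r) \<ge> 2" "c1 \<noteq> 0" "c3 \<noteq> 0" "equiv_map (c1, c2, c3, c4) (p, a) = (q, b)"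
  shows "is_solved q b \<longleftrightarrow> is_solved p a"
proof -
  have q: "q = fst (equiv_map (c1, c2, c3, c4) (p, a))" and b: "b = snd (equiv_map (c1, c2, c3, c4) (p, a))"
    using assms(4) by simp_all
  let ?k = "c3 / c1\<^sup>2"
  have 1: "(\<Sum>j = 2..CARD('r). coef b j * der q 0 j) = c3 / c1\<^sup>2 * (\<Sum>j = 2..CARD('r). coef a j * der p 0 j)"
    unfolding sum_distrib_left
    using assms(2,3) by (intro sum.cong) (auto simp: q b equiv_map_simps field_simps power2_eq_square)
  have 2: "der q 1 0 + der q 0 0 * der q 0 1 = c3 / c1\<^sup>2 * (der p 1 0 + der p 0 0 * der p 0 1)"
    using assms(1-3) by (simp add: q equiv_map_simps field_simps power2_eq_square)
  have 3: "coef b 0 * der q 0 0 + inhom b = c3 / c1\<^sup>2 * (coef a 0 * der p 0 0 + inhom a)"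
    using assms(1-3) by (simp add: q b equiv_map_simps field_simps power2_eq_square)
  have "is_solved q b \<longleftrightarrow> ?k * (der p 1 0 + der p 0 0 * der p 0 1)
      = ?k * ((\<Sum>j = 2..CARD('r). coef a j * der p 0 j) + (coef a 0 * der p 0 0 + inhom a))"
    by (simp only: is_solved_def 1 2 3 add.assoc distrib_left[of ?k "sum _ _"])
  then show ?thesis
    using assms(2,3) by (simp add: is_solved_def add.assoc)
qed

lemma local_diffeo_equiv_map:
  fixes D :: "'r::finite joint set"
  assumes "open D" "c1 \<noteq> 0" "c3 \<noteq> 0"
  shows "local_diffeo D (restrict (equiv_map (c1, c2, c3, c4)) D)"
proof -
  let ?f = "equiv_map (c1, c2, c3, c4) :: 'r joint \<Rightarrow> 'r joint"
  let ?g = "equiv_map (1 / c1, - c2 / c1, 1 / c3, - c4 / c3) :: 'r joint \<Rightarrow> 'r joint"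
  have gf: "?g (?f z) = z" and fg: "?f (?g z) = z" for z
    using assms(2,3) by (simp_all only: equiv_map_compose) (simp_all add: equiv_map_identity)
  \<comment> \<open>The image is a preimage under the continuous inverse, hence open.\<close>
  have "restrict ?f D ` D = ?g -` D"
    using fg gf by (auto simp: image_iff) metis
  moreover have "open (?g -` D)"
    using has_derivative_continuous_on[OF has_derivative_at_withinI[OF has_derivative_equiv_map], of UNIV] assms(1)
    by (intro open_vimage)
  ultimately have op: "open (restrict ?f D ` D)" by simp
  have inj: "inj_on (restrict ?f D) D"
    by (rule inj_on_inverseI[of _ ?g]) (simp only: gf restrict_apply if_True)
  have "smooth_on (restrict ?f D ` D) (inv_into D (restrict ?f D))"
  proof (rule smooth_on_cong[OF smooth_on_equiv_map_fixed[OF op] op])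
    show "?g w = inv_into D (restrict ?f D) w" if "w \<in> restrict ?f D ` D" for w
      using that inv_into_f_f[OF inj] gf by (auto simp: image_iff)
  qed
  moreover have "smooth_on D (restrict ?f D)"
    by (rule smooth_on_cong[OF smooth_on_equiv_map_fixed[OF assms(1)] assms(1)]) simp
  ultimately show ?thesis
    using op inj assms(1) by (simp add: local_diffeo_def)
qed

text \<open>The differential is the map without its shifts \<open>c2\<close> and \<open>c4\<close>,
  and it multiplies the contact form with index \<open>(i, k)\<close> by
  \<open>(c3 / c1) / (c1 ^ i * c3 ^ k)\<close>.\<close>

lemma respects_contact_equiv_map:
  fixes D :: "'r::finite joint set"
  assumes "open D" "c1 \<noteq> 0" "c3 \<noteq> 0"
  shows "respects_contact D (restrict (equiv_map (c1, c2, c3, c4)) D)"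
  unfolding respects_contact_def
proof (intro ballI allI impI)
  fix z v :: "'r joint" assume z: "z \<in> D" and v: "contact_vector (fst z) (fst v)"
  have "(restrict (equiv_map (c1, c2, c3, c4)) D has_derivative equiv_map (c1, 0, c3, 0)) (at z)"
    by (rule has_derivative_transform_within_open[OF has_derivative_equiv_map assms(1) z]) simp
  then have d: "frechet_derivative (restrict (equiv_map (c1, c2, c3, c4)) D) (at z) = equiv_map (c1, 0, c3, 0)"
    by (rule frechet_derivative_at[symmetric])
  show "contact_vector (fst (restrict (equiv_map (c1, c2, c3, c4)) D z))
      (fst (frechet_derivative (restrict (equiv_map (c1, c2, c3, c4)) D) (at z) v))"
    using v z assms(2,3)
    by (auto simp: contact_vector_def contact_form_def d equiv_map_simps field_simps)
qed

lemma smooth_on_affine: "open S \<Longrightarrow> smooth_on S (\<lambda>x :: real. a + (x - x0) *\<^sub>R b)"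
  by (intro smooth_on_add smooth_on_const
      smooth_on_linear_compose[OF _ bounded_linear_scaleR_left, of S "\<lambda>x. x - x0"])
    (auto intro: smooth_on_add[of S "\<lambda>x. x" "\<lambda>_. - x0", simplified] smooth_on_id smooth_on_const)

lemma preserves_class_equiv_map:
  fixes D :: "'r::finite joint set"
  assumes r: "CARD('r) \<ge> 2" and c: "c1 \<noteq> 0" "c3 \<noteq> 0"
  shows "preserves_class D (restrict (equiv_map (c1, c2, c3, c4)) D)"
  unfolding preserves_class_def
proof safe
  fix I and \<theta> :: "real \<Rightarrow> 'r arb"
  assume "(I, \<theta>) \<in> arbitrary_elements"
  then have I: "open I" "is_interval I" "I \<noteq> {}" "smooth_on I \<theta>"
      "\<forall>x\<in>I. coef (\<theta> x) (CARD('r)) \<noteq> 0"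
    by (auto simp: arbitrary_elements_def)
  define J where "J = (\<lambda>x. c3 * x + c4) ` I"
  \<comment> \<open>The arbitrary elements transform independently of the jet, so the zero jet may
    stand in the first slot. The new tuple \<open>\<theta>'\<close> is \<open>L\<close> applied to
    \<open>\<theta>\<close> at the old \<open>x\<close>.\<close>
  define L where "L = (\<lambda>a :: 'r arb. snd (equiv_map (c1, 0, c3, 0) (0, a)))"
  define \<theta>' where "\<theta>' = (\<lambda>y. L (\<theta> (y *\<^sub>R (1 / c3) + - c4 / c3)))"
  have J: "x \<in> J \<longleftrightarrow> (x - c4) / c3 \<in> I" for x
    using c by (force simp: J_def image_iff)
  have "linear L"
    unfolding L_def
    by (rule linearI; rule arb_eqI) (simp_all add: equiv_map_simps distrib_left add_divide_distrib)
  have "open J"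
    unfolding J_def using I(1) c
    using open_affinity[of I c3 c4] by (simp add: image_def add.commute)
  moreover have "is_interval J"
    using I(2) unfolding J_def
    by (auto simp: is_interval_connected_1 intro!: connected_continuous_image continuous_intros)
  moreover have "J \<noteq> {}" using I(3) by (simp add: J_def)
  moreover have "smooth_on J \<theta>'"
    unfolding \<theta>'_def
  proof (rule smooth_on_linear_compose[OF \<open>open J\<close>, of L])
    show "bounded_linear L" using \<open>linear L\<close> by (simp add: linear_conv_bounded_linear)
    show "smooth_on J (\<lambda>y. \<theta> (y *\<^sub>R (1 / c3) + - c4 / c3))"
      by (rule smooth_on_compose_affine[OF \<open>open J\<close> bounded_linear_scaleR_left _ I(4)])
        (simp add: J diff_divide_distrib)
  qed
  moreover have "\<forall>x\<in>J. coef (\<theta>' x) (CARD('r)) \<noteq> 0"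
    using I(5) c r by (auto simp: J \<theta>'_def L_def equiv_map_simps diff_divide_distrib)
  ultimately have mem: "(J, \<theta>') \<in> arbitrary_elements"
    by (simp add: arbitrary_elements_def)
  have eq: "\<theta>' (c3 * x + c4) = L (\<theta> x)" for x
    using c by (simp add: \<theta>'_def add_divide_distrib)
  have "maps_to_class_member D (restrict (equiv_map (c1, c2, c3, c4)) D) I \<theta> J \<theta>'"
    unfolding maps_to_class_member_def
  proof (intro allI impI)
    fix p q :: "'r jet" and \<eta>
    assume p: "xvar p \<in> I" "(p, \<theta> (xvar p)) \<in> D"
      "restrict (equiv_map (c1, c2, c3, c4)) D (p, \<theta> (xvar p)) = (q, \<eta>)"
    then have q: "equiv_map (c1, c2, c3, c4) (p, \<theta> (xvar p)) = (q, \<eta>)" by simp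
    have xq: "xvar q = c3 * xvar p + c4"
      using equiv_map_simps(2)[of c1 c2 c3 c4 "(p, \<theta> (xvar p))"] by (simp add: q)
    have "\<eta> = snd (equiv_map (c1, c2, c3, c4) (p, \<theta> (xvar p)))"
      by (simp add: q)
    then have "\<eta> = L (\<theta> (xvar p))"
      by (intro arb_eqI) (simp_all add: L_def equiv_map_simps)
    then show "xvar q \<in> J \<and> \<eta> = \<theta>' (xvar q) \<and>
        (is_solved p (\<theta> (xvar p)) \<longleftrightarrow> is_solved q (\<theta>' (xvar q)))"
      using is_solved_equiv_map[OF r c q] p(1) by (auto simp: xq eq J_def)
  qed
  then show "\<exists>(J, \<theta>') \<in> arbitrary_elements.
      maps_to_class_member D (restrict (equiv_map (c1, c2, c3, c4)) D) I \<theta> J \<theta>'"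
    using mem by blast
qed

lemma usual_equivalence_equiv_map:
  fixes D :: "'r::finite joint set"
  assumes "CARD('r) \<ge> 2" "D \<in> transformation_domains" "c \<in> params"
  shows "usual_equivalence D (restrict (equiv_map c) D)"
proof -
  obtain c1 c2 c3 c4 where c: "c = (c1, c2, c3, c4)" "c1 \<noteq> 0" "c3 \<noteq> 0"
    using assms(3) by (auto simp: params_def)
  have D: "open D" using assms(2) by (auto simp: transformation_domains_def)
  have "projectable D (restrict (equiv_map c) D)"
    by (auto simp: projectable_def jet_agree_def c equiv_map_simps)
  then show ?thesis
    using assms(1,2) D c
    by (simp add: usual_equivalence_def local_diffeo_equiv_map respects_contact_equiv_map
        preserves_class_equiv_map)
qed

section \<open>Derivatives along lines and constancy on segments\<close>

text \<open>Both sides are differentiated in \<open>h\<close> at \<open>0\<close>. This turns an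
  identity along two short lines, possibly through different points and up to an additive constant,
  into an identity of differentials; a constant \<open>g\<close> gives the vanishing of
  \<open>f' v\<close>.\<close>

lemma directional_derivative_eq:
  fixes f :: "'a::real_normed_vector \<Rightarrow> 'c::real_normed_vector" and g :: "'b::real_normed_vector \<Rightarrow> 'c"
  assumes f: "(f has_derivative f') (at z)" and g: "(g has_derivative g') (at w)"
    and eq: "\<forall>\<^sub>F h in nhds 0. f (z + h *\<^sub>R v) = g (w + h *\<^sub>R v') + k"
  shows "f' v = g' v'"
proof -
  have line: "((\<lambda>h::real. y + h *\<^sub>R e) has_derivative (\<lambda>h. h *\<^sub>R e)) (at 0)" for y e :: "'x::real_normed_vector"
    by (auto intro!: derivative_eq_intros)
  have "((\<lambda>h. f (z + h *\<^sub>R v)) has_derivative (\<lambda>h. f' (h *\<^sub>R v))) (at 0)"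
    using has_derivative_compose[OF line, of f f' z v] f by simp
  moreover have "((\<lambda>h. g (w + h *\<^sub>R v') + k) has_derivative (\<lambda>h. g' (h *\<^sub>R v'))) (at 0)"
    using has_derivative_compose[OF line, of g g' w v'] g by (auto intro!: derivative_eq_intros)
  then have "((\<lambda>h. f (z + h *\<^sub>R v)) has_derivative (\<lambda>h. g' (h *\<^sub>R v'))) (at 0)"
    by (rule has_derivative_transform_eventually)
      (use eq eventually_nhds_x_imp_x[OF eq] in \<open>auto simp: eventually_at_filter elim!: eventually_mono\<close>)
  ultimately have "(\<lambda>h. f' (h *\<^sub>R v)) = (\<lambda>h. g' (h *\<^sub>R v'))"
    by (rule has_derivative_unique)
  from fun_cong[OF this, of 1] show ?thesis by simp
qed

text \<open>The restriction to the segment has zero derivative. Only the derivative in the direction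
  of the segment enters, so \<open>f\<close> may vary in all others.\<close>

lemma constant_between:
  fixes f :: "'a::real_normed_vector \<Rightarrow> 'b::real_normed_vector"
  assumes "convex C" "\<And>z. z \<in> C \<Longrightarrow> (f has_derivative f' z) (at z)"
    and "\<And>z. z \<in> C \<Longrightarrow> f' z (w' - w) = 0" and "w \<in> C" "w' \<in> C"
  shows "f w = f w'"
proof -
  have seg: "w + s *\<^sub>R (w' - w) \<in> C" if "s \<in> {0..1}" for s
    using convexD_alt[OF assms(1,4,5)] that by (simp add: algebra_simps)
  have "((\<lambda>s. f (w + s *\<^sub>R (w' - w))) has_derivative (\<lambda>_. 0)) (at s within {0..1})"
    if s: "s \<in> {0..1}" for s
  proof -
    have "((\<lambda>s. w + s *\<^sub>R (w' - w)) has_derivative (\<lambda>h. h *\<^sub>R (w' - w))) (at s within {0..1})"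
      by (auto intro!: derivative_eq_intros)
    from has_derivative_compose[OF this assms(2)[OF seg[OF s]]]
    have "((\<lambda>s. f (w + s *\<^sub>R (w' - w))) has_derivative
        (\<lambda>h. f' (w + s *\<^sub>R (w' - w)) (h *\<^sub>R (w' - w)))) (at s within {0..1})" .
    moreover have "f' (w + s *\<^sub>R (w' - w)) (h *\<^sub>R (w' - w)) = 0" for h
      using assms(3)[OF seg[OF s]]
        linear_scale[OF has_derivative_linear[OF assms(2)[OF seg[OF s]]]] by simp
    ultimately show ?thesis by simp
  qed
  then obtain c where "\<And>s. s \<in> {0..1} \<Longrightarrow> f (w + s *\<^sub>R (w' - w)) = c"
    using has_derivative_zero_constant[of "{0..1::real}" "\<lambda>s. f (w + s *\<^sub>R (w' - w))"] by auto
  from this[of 0] this[of 1] show ?thesis by simp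
qed

lemma eventually_nhds_0_nonzero:
  assumes "eventually P (nhds (0::real))"
  obtains h where "h \<noteq> 0" "P h"
proof -
  obtain d where "d > 0" "\<And>h. dist h 0 < d \<Longrightarrow> P h"
    using assms by (auto simp: eventually_nhds_metric)
  then have "P (d / 2)" "d / 2 \<noteq> 0" by auto
  then show ?thesis using that by blast
qed

lemma eventually_line_in_open:
  fixes z :: "'a::real_normed_vector"
  assumes "open S" "z \<in> S"
  shows "\<forall>\<^sub>F h in nhds 0. z + h *\<^sub>R v \<in> S"
proof -
  have "((\<lambda>h. z + h *\<^sub>R v) \<longlongrightarrow> z + 0 *\<^sub>R v) (nhds 0)"
    by (intro tendsto_intros filterlim_ident)
  then show ?thesis
    using assms by (simp add: tendsto_def)
qed

section \<open>Jets and tangent vectors\<close>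

definition jvec :: "real \<Rightarrow> real \<Rightarrow> (nat \<Rightarrow> nat \<Rightarrow> real) \<Rightarrow> 'r::finite jet" where
  "jvec t x f = (t, x, \<chi> a. case Rep_jet_index a of (i, k) \<Rightarrow> f i k)"

lemma jvec_simps [simp]:
  "tvar (jvec t x f) = t" "xvar (jvec t x f) = x"
  "i + k \<le> CARD('r) \<Longrightarrow> der (jvec t x f :: 'r::finite jet) i k = f i k"
  by (simp_all add: jvec_def tvar_def xvar_def der_def Rep_Abs_jet_index)

definition et :: "'r::finite jet" where "et = jvec 1 0 (\<lambda>_ _. 0)"
definition ex :: "'r::finite jet" where "ex = jvec 0 1 (\<lambda>_ _. 0)"
definition eu :: "nat \<Rightarrow> nat \<Rightarrow> 'r::finite jet" where
  "eu i k = jvec 0 0 (\<lambda>i' k'. of_bool (i' = i \<and> k' = k))"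

lemma unit_simps [simp]:
  "tvar et = 1" "xvar et = 0" "i + k \<le> CARD('r) \<Longrightarrow> der (et :: 'r::finite jet) i k = 0"
  "tvar ex = 0" "xvar ex = 1" "i + k \<le> CARD('r) \<Longrightarrow> der (ex :: 'r::finite jet) i k = 0"
  "tvar (eu i' k') = 0" "xvar (eu i' k') = 0"
  "i + k \<le> CARD('r) \<Longrightarrow> der (eu i' k' :: 'r::finite jet) i k = of_bool (i = i' \<and> k = k')"
  by (simp_all add: et_def ex_def eu_def)

text \<open>Total derivatives as tangent vectors. Their components of top order are junk, as they do
  not enter the contact conditions.\<close>

definition Dt :: "'r::finite jet \<Rightarrow> 'r jet" where "Dt p = jvec 1 0 (\<lambda>i k. der p (Suc i) k)"
definition Dx :: "'r::finite jet \<Rightarrow> 'r jet" where "Dx p = jvec 0 1 (\<lambda>i k. der p i (Suc k))"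

lemma total_simps [simp]:
  "tvar (Dt p) = 1" "xvar (Dt p) = 0"
  "i + k \<le> CARD('r) \<Longrightarrow> der (Dt p :: 'r::finite jet) i k = der p (Suc i) k"
  "tvar (Dx p) = 0" "xvar (Dx p) = 1"
  "i + k \<le> CARD('r) \<Longrightarrow> der (Dx p :: 'r::finite jet) i k = der p i (Suc k)"
  by (simp_all add: Dt_def Dx_def)

lemma contact_vector_total: "contact_vector p (Dt p)" "contact_vector p (Dx p)"
  by (simp_all add: contact_vector_def contact_form_def)

definition cvec :: "(nat \<Rightarrow> real) \<Rightarrow> real \<Rightarrow> 'r::finite arb" where
  "cvec f b = (\<chi> a. f (Rep_coef_index a), b)"

lemma cvec_simps [simp]:
  "j = 0 \<or> 2 \<le> j \<and> j \<le> CARD('r) \<Longrightarrow> coef (cvec f b :: 'r::finite arb) j = f j"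
  "inhom (cvec f b) = b"
  by (simp_all add: cvec_def coef_def inhom_def Rep_Abs_coef_index)

section \<open>The equation as a hyperplane in the arbitrary elements\<close>

text \<open>For a fixed jet the equation is the affine hyperplane \<open>rhs p a = lhs p\<close> in
  the space of the values \<open>a\<close>. Its linear form takes the value 1 on the direction of B,
  so it is never zero.\<close>

definition rhs :: "'r::finite jet \<Rightarrow> 'r arb \<Rightarrow> real" where
  "rhs p a = (\<Sum>j = 2..CARD('r). coef a j * der p 0 j) + coef a 0 * der p 0 0 + inhom a"

definition lhs :: "'r::finite jet \<Rightarrow> real" where
  "lhs p = der p 1 0 + der p 0 0 * der p 0 1"

lemma is_solved_iff: "is_solved p a \<longleftrightarrow> lhs p = rhs p a"
  by (simp add: is_solved_def lhs_def rhs_def)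

lemma linear_rhs: "linear (rhs p)"
  by (rule linearI) (simp_all add: rhs_def algebra_simps sum.distrib sum_distrib_left)

lemma rhs_add: "rhs p (a + b) = rhs p a + rhs p b"
  and rhs_diff: "rhs p (a - b) = rhs p a - rhs p b"
  and rhs_scale: "rhs p (s *\<^sub>R a) = s * rhs p a"
  using linear_rhs[of p] by (simp_all add: linear_add linear_diff linear_scale)

text \<open>Test vectors that read the coefficients back from the linear form; the first one fixes
  its normalization.\<close>

lemma rhs_cvec:
  fixes p :: "'r::finite jet"
  shows "rhs p (cvec (\<lambda>_. 0) 1) = 1"
    and "j = 0 \<or> 2 \<le> j \<and> j \<le> CARD('r) \<Longrightarrow> rhs p (cvec (\<lambda>i. of_bool (i = j)) 0) = der p 0 j"
proof -
  show "rhs p (cvec (\<lambda>_. 0) 1) = 1" by (simp add: rhs_def)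
  assume j: "j = 0 \<or> 2 \<le> j \<and> j \<le> CARD('r)"
  have "(\<Sum>i = 2..CARD('r). coef (cvec (\<lambda>i. of_bool (i = j)) 0 :: 'r arb) i * der p 0 i)
      = (\<Sum>i = 2..CARD('r). if i = j then der p 0 i else 0)"
    by (intro sum.cong) auto
  then show "rhs p (cvec (\<lambda>i. of_bool (i = j)) 0) = der p 0 j"
    using j by (auto simp: rhs_def)
qed

lemma rhs_cong:
  fixes p q :: "'r::finite jet"
  assumes "der p 0 0 = der q 0 0" "\<forall>j\<in>{2..CARD('r)}. der p 0 j = der q 0 j"
  shows "rhs p a = rhs q a"
  using assms by (simp add: rhs_def)

lemma jet_agree_0: "jet_agree 0 p q \<longleftrightarrow> tvar p = tvar q \<and> xvar p = xvar q \<and> der p 0 0 = der q 0 0"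
  by (auto simp: jet_agree_def)

lemma jet_agree_1: "jet_agree (Suc 0) p q \<longleftrightarrow> tvar p = tvar q \<and> xvar p = xvar q \<and>
    der p 0 0 = der q 0 0 \<and> der p (Suc 0) 0 = der q (Suc 0) 0 \<and> der p 0 (Suc 0) = der q 0 (Suc 0)"
proof -
  have "i + k \<le> Suc 0 \<longleftrightarrow> (i, k) \<in> {(0, 0), (Suc 0, 0), (0, Suc 0)}" for i k :: nat by auto
  then show ?thesis by (auto simp: jet_agree_def)
qed

lemma abs_tvar_le: "\<bar>tvar (fst z)\<bar> \<le> norm z" and abs_xvar_le: "\<bar>xvar (fst z)\<bar> \<le> norm z"
proof -
  have fst: "norm (fst y) \<le> norm y" for y :: "'x::real_normed_vector \<times> 'y::real_normed_vector"
    by (cases y) (simp add: norm_fst_le)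
  have snd: "norm (snd y) \<le> norm y" for y :: "'x::real_normed_vector \<times> 'y::real_normed_vector"
    by (cases y) (simp add: norm_snd_le)
  show "\<bar>tvar (fst z)\<bar> \<le> norm z"
    using fst[of z] fst[of "fst z"] by (simp add: tvar_def)
  show "\<bar>xvar (fst z)\<bar> \<le> norm z"
    using fst[of z] snd[of "fst z"] fst[of "snd (fst z)"] by (simp add: xvar_def)
qed

lemma norm_et [simp]: "norm (et :: 'r::finite jet) = 1" and norm_ex [simp]: "norm (ex :: 'r jet) = 1"
proof -
  have "(\<chi> a :: 'r jet_index. case Rep_jet_index a of (i, k) \<Rightarrow> 0) = (0 :: real ^ 'r jet_index)"
    by (simp add: vec_eq_iff split: prod.splits)
  then show "norm (et :: 'r jet) = 1" "norm (ex :: 'r jet) = 1"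
    by (simp_all add: et_def ex_def jvec_def norm_Pair)
qed

text \<open>Here \<open>\<xi>\<close> and \<open>\<tau>\<close> are the total derivatives of the new
  t by x and by t, \<open>\<mu>\<close> is \<open>Xx\<close> and \<open>q\<close> the new u_t;
  \<open>A\<close>, \<open>B\<close> are the derivatives of the new u_t, and \<open>C\<close>,
  \<open>E\<close> those of the new u_x, by u_t and u_x respectively. The equations give
  \<open>E * \<mu> = A * \<tau>\<close> and then \<open>2 * \<xi> * (A * \<tau>) = 0\<close>, where
  \<open>A * \<tau>\<close> is nonzero because
  \<open>(A * \<tau>) * \<tau> = Uu * Tt\<close>.\<close>

lemma T_gradient_algebra:
  fixes A B C E q \<xi> \<tau> \<mu> Uu Tu Tt ut :: real
  assumes "A * \<xi> + C * \<mu> = 0" "A * \<tau> + q * Tu = Uu" "B * \<xi> + q * Tu + E * \<mu> = Uu" "B * \<tau> = 0"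
    and "C * \<tau> = E * \<xi>" "Uu * ut = q * \<tau>" "\<tau> = Tt + Tu * ut"
    and "\<mu> \<noteq> 0" "Uu \<noteq> 0" "Tt \<noteq> 0"
  shows "\<xi> = 0"
proof -
  \<comment> \<open>If \<open>\<tau>\<close> vanished, then so would \<open>Uu * ut\<close>, hence
    \<open>ut\<close>, and \<open>\<tau>\<close> would be \<open>Tt\<close>.\<close>
  have "\<tau> \<noteq> 0"
    using assms(6-) by auto
  then have E: "E * \<mu> = A * \<tau>"
    using assms(2-4) by auto
  have "0 = (A * \<xi> + C * \<mu>) * \<tau>" using assms(1) by simp
  also have "\<dots> = A * \<xi> * \<tau> + (C * \<tau>) * \<mu>" by algebra
  also have "\<dots> = 2 * \<xi> * (A * \<tau>)" using E assms(5) by algebra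
  finally have "\<xi> * (A * \<tau>) = 0" by simp
  moreover have "A * \<tau> = Uu - q * Tu" using assms(2) by simp
  then have "(A * \<tau>) * \<tau> = Uu * \<tau> - Tu * (q * \<tau>)" by (simp add: left_diff_distrib)
  then have "(A * \<tau>) * \<tau> = Uu * \<tau> - Tu * (Uu * ut)" by (simp only: assms(6))
  then have "(A * \<tau>) * \<tau> = Uu * Tt"
    by (simp add: assms(7) algebra_simps)
  then have "A * \<tau> \<noteq> 0" using assms(9,10) by auto
  ultimately show ?thesis by simp
qed

lemma rhs_shift:
  fixes p q :: "'r::finite jet"
  assumes j: "j = 0 \<or> 2 \<le> j \<and> j \<le> CARD('r)"
    and eq: "\<And>i. i = 0 \<or> 2 \<le> i \<and> i \<le> CARD('r) \<Longrightarrow> der q 0 i = der p 0 i + s * of_bool (i = j)"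
  shows "rhs q a = rhs p a + coef a j * s"
proof -
  have "(\<Sum>i = 2..CARD('r). coef a i * der q 0 i)
      = (\<Sum>i = 2..CARD('r). coef a i * der p 0 i + (if i = j then coef a i * s else 0))"
    using eq by (intro sum.cong) (auto simp: distrib_left)
  also have "\<dots> = (\<Sum>i = 2..CARD('r). coef a i * der p 0 i) + (if 2 \<le> j then coef a j * s else 0)"
    using j by (auto simp: sum.distrib)
  finally show ?thesis
    using j eq[of 0] by (auto simp: rhs_def distrib_left)
qed

section \<open>Necessary form of an equivalence transformation\<close>

locale usual_equivalence_transformation =
  fixes D :: "'r::finite joint set" and \<Phi> :: "'r joint \<Rightarrow> 'r joint"
  assumes order: "CARD('r) \<ge> 2" and equivalence: "usual_equivalence D \<Phi>"
begin

section \<open>The differential and the projections\<close>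

lemma order_simps [simp]: "Suc 0 \<le> CARD('r)" "Suc (Suc 0) \<le> CARD('r)" "2 \<le> CARD('r)"
  using order by auto

lemma open_D: "open D" and connected_D: "connected D" and nonempty_D: "D \<noteq> {}"
  and solved_lift: "(p, a) \<in> D \<Longrightarrow> \<exists>q. (q, a) \<in> D \<and> jet_agree 0 p q \<and> is_solved q a"
  using equivalence by (auto simp: usual_equivalence_def transformation_domains_def)

lemma projection:
  "s \<le> CARD('r) \<Longrightarrow> z \<in> D \<Longrightarrow> w \<in> D \<Longrightarrow> jet_agree s (fst z) (fst w) \<Longrightarrow>
    jet_agree s (fst (\<Phi> z)) (fst (\<Phi> w))"
  using equivalence by (auto simp: usual_equivalence_def projectable_def)

text \<open>Projectability at the full order \<open>CARD('r)\<close>: the new jet does not see the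
  arbitrary elements.\<close>

lemma fst_eq: "z \<in> D \<Longrightarrow> w \<in> D \<Longrightarrow> fst z = fst w \<Longrightarrow> fst (\<Phi> z) = fst (\<Phi> w)"
  by (rule jet_eqI, rule projection) (simp_all add: jet_agree_def)

definition d\<Phi> :: "'r joint \<Rightarrow> 'r joint \<Rightarrow> 'r joint" where
  "d\<Phi> z = frechet_derivative \<Phi> (at z)"

text \<open>The zero in the slot of the arbitrary elements loses no information about the new jet,
  by \<open>fst_d\<Phi>\<close>.\<close>

definition dj :: "'r joint \<Rightarrow> 'r jet \<Rightarrow> 'r jet" where
  "dj z v = fst (d\<Phi> z (v, 0))"

lemma smooth: "smooth_on D \<Phi>" "inj_on \<Phi> D" "open (\<Phi> ` D)" "smooth_on (\<Phi> ` D) (inv_into D \<Phi>)"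
  using equivalence by (auto simp: usual_equivalence_def local_diffeo_def)

lemma has_derivative_\<Phi>: "z \<in> D \<Longrightarrow> (\<Phi> has_derivative d\<Phi> z) (at z)"
  unfolding d\<Phi>_def by (rule smooth_on_has_derivative[OF smooth(1)])

lemma linear_d\<Phi>: "z \<in> D \<Longrightarrow> linear (d\<Phi> z)"
  using has_derivative_linear[OF has_derivative_\<Phi>] .

lemma inj_d\<Phi>:
  assumes "z \<in> D"
  shows "inj (d\<Phi> z)"
proof -
  let ?g = "inv_into D \<Phi>"
  have "(?g has_derivative frechet_derivative ?g (at (\<Phi> z))) (at (\<Phi> z))"
    using smooth_on_has_derivative[OF smooth(4)] assms by blast
  from has_derivative_compose[OF has_derivative_\<Phi>[OF assms] this]
  have "((\<lambda>x. ?g (\<Phi> x)) has_derivative (\<lambda>v. frechet_derivative ?g (at (\<Phi> z)) (d\<Phi> z v))) (at z)" .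
  then have "((\<lambda>x. x) has_derivative (\<lambda>v. frechet_derivative ?g (at (\<Phi> z)) (d\<Phi> z v))) (at z)"
    by (rule has_derivative_transform_within_open[OF _ open_D assms]) (simp add: smooth(2))
  from has_derivative_unique[OF this has_derivative_ident] show ?thesis
    by (metis injI)
qed

lemma surj_d\<Phi>: "z \<in> D \<Longrightarrow> surj (d\<Phi> z)"
  using linear_inj_imp_surj[OF linear_d\<Phi> inj_d\<Phi>] .

lemma has_derivative_tvar: "z \<in> D \<Longrightarrow> ((\<lambda>z. tvar (fst (\<Phi> z))) has_derivative (\<lambda>v. tvar (fst (d\<Phi> z v)))) (at z)"
  and has_derivative_xvar: "z \<in> D \<Longrightarrow> ((\<lambda>z. xvar (fst (\<Phi> z))) has_derivative (\<lambda>v. xvar (fst (d\<Phi> z v)))) (at z)"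
  and has_derivative_der: "z \<in> D \<Longrightarrow> ((\<lambda>z. der (fst (\<Phi> z)) i k) has_derivative (\<lambda>v. der (fst (d\<Phi> z v)) i k)) (at z)"
  and has_derivative_snd: "z \<in> D \<Longrightarrow> ((\<lambda>z. snd (\<Phi> z)) has_derivative (\<lambda>v. snd (d\<Phi> z v))) (at z)"
  by (intro bounded_linear.has_derivative[OF bounded_linear_tvar]
      bounded_linear.has_derivative[OF bounded_linear_xvar]
      bounded_linear.has_derivative[OF bounded_linear_der]
      bounded_linear.has_derivative[OF bounded_linear_fst]
      bounded_linear.has_derivative[OF bounded_linear_snd] has_derivative_\<Phi>; assumption)+

text \<open>Projectability, differentiated: if points and directions have the same
  \<open>s\<close>-jets, then so have corresponding points of the two lines, and hence their
  images.\<close>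

lemma transfer_d\<Phi>:
  assumes "s \<le> CARD('r)" "z \<in> D" "w \<in> D"
    and "jet_agree s (fst z) (fst w)" "jet_agree s (fst v) (fst v')"
  shows "jet_agree s (fst (d\<Phi> z v)) (fst (d\<Phi> w v'))"
proof -
  have "\<forall>\<^sub>F h in nhds 0. z + h *\<^sub>R v \<in> D \<and> w + h *\<^sub>R v' \<in> D"
    by (intro eventually_conj eventually_line_in_open open_D assms)
  then have *: "\<forall>\<^sub>F h in nhds 0. jet_agree s (fst (\<Phi> (z + h *\<^sub>R v))) (fst (\<Phi> (w + h *\<^sub>R v')))"
  proof eventually_elim
    case (elim h)
    then show ?case
      by (intro projection assms(1)) (use assms(4,5) in \<open>auto simp: jet_agree_def\<close>)
  qed
  have "tvar (fst (d\<Phi> z v)) = tvar (fst (d\<Phi> w v'))"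
    by (rule directional_derivative_eq[OF has_derivative_tvar has_derivative_tvar, where k = 0])
      (use * assms in \<open>auto simp: jet_agree_def elim!: eventually_mono\<close>)
  moreover have "xvar (fst (d\<Phi> z v)) = xvar (fst (d\<Phi> w v'))"
    by (rule directional_derivative_eq[OF has_derivative_xvar has_derivative_xvar, where k = 0])
      (use * assms in \<open>auto simp: jet_agree_def elim!: eventually_mono\<close>)
  moreover have "der (fst (d\<Phi> z v)) i k = der (fst (d\<Phi> w v')) i k" if "i + k \<le> s" for i k
    by (rule directional_derivative_eq[OF has_derivative_der has_derivative_der, where k = 0])
      (use * assms that in \<open>auto simp: jet_agree_def elim!: eventually_mono\<close>)
  ultimately show ?thesis by (simp add: jet_agree_def)
qed

lemma fst_d\<Phi>: "z \<in> D \<Longrightarrow> fst (d\<Phi> z v) = dj z (fst v)"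
  unfolding dj_def by (rule jet_eqI, rule transfer_d\<Phi>) (auto simp: jet_agree_def)

lemma transfer:
  assumes "s \<le> CARD('r)" "z \<in> D" "w \<in> D" "jet_agree s (fst z) (fst w)" "jet_agree s v v'"
  shows "jet_agree s (dj z v) (dj w v')"
  unfolding dj_def using assms by (intro transfer_d\<Phi>) auto

lemma linear_dj: "z \<in> D \<Longrightarrow> linear (dj z)"
  unfolding dj_def
  using linear_compose[OF linear_compose[OF _ linear_d\<Phi>] linear_fst, of "\<lambda>v. (v, 0)"]
  by (simp add: o_def linear_iff)

lemma dj_simps:
  assumes "z \<in> D"
  shows "dj z (v + w) = dj z v + dj z w" "dj z (v - w) = dj z v - dj z w"
    "dj z (s *\<^sub>R v) = s *\<^sub>R dj z v" "dj z 0 = 0"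
  using linear_dj[OF assms] by (simp_all add: linear_add linear_diff linear_scale linear_0)

text \<open>The prolongation formula. For \<open>Dt\<close> and \<open>Dx\<close> it expresses the
  total derivatives of a new derivative of u through the new derivatives of one order
  higher.\<close>

lemma contact:
  assumes "z \<in> D" "i + k < CARD('r)" "contact_vector (fst z) v"
  shows "der (dj z v) i k = der (fst (\<Phi> z)) (Suc i) k * tvar (dj z v)
    + der (fst (\<Phi> z)) i (Suc k) * xvar (dj z v)"
proof -
  have "contact_vector (fst (\<Phi> z)) (fst (d\<Phi> z (v, 0)))"
    using equivalence assms(1,3) unfolding usual_equivalence_def respects_contact_def d\<Phi>_def
    by (metis fst_conv)
  then show ?thesis
    using assms(2) by (fastforce simp: contact_vector_def contact_form_def dj_def algebra_simps)
qed

section \<open>Images of constant and affine tuples\<close>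

text \<open>Affine tuples are rich enough as test tuples: at \<open>x0\<close> they take the value
  \<open>a\<close> with any slope \<open>b\<close>. The interval \<open>I\<close> has to avoid the
  zeros of their leading coefficient.\<close>

lemma class_image:
  assumes "open I" "is_interval I" "I \<noteq> {}" "\<forall>x\<in>I. coef (a + (x - x0) *\<^sub>R b) (CARD('r)) \<noteq> 0"
  obtains J \<theta>' where "smooth_on J \<theta>'"
    "\<And>p. xvar p \<in> I \<Longrightarrow> (p, a + (xvar p - x0) *\<^sub>R b) \<in> D \<Longrightarrow>
      xvar (fst (\<Phi> (p, a + (xvar p - x0) *\<^sub>R b))) \<in> J \<and>
      snd (\<Phi> (p, a + (xvar p - x0) *\<^sub>R b)) = \<theta>' (xvar (fst (\<Phi> (p, a + (xvar p - x0) *\<^sub>R b)))) \<and>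
      (is_solved p (a + (xvar p - x0) *\<^sub>R b) \<longleftrightarrow>
        is_solved (fst (\<Phi> (p, a + (xvar p - x0) *\<^sub>R b))) (snd (\<Phi> (p, a + (xvar p - x0) *\<^sub>R b))))"
proof -
  have "(I, \<lambda>x. a + (x - x0) *\<^sub>R b) \<in> arbitrary_elements"
    using assms by (simp add: arbitrary_elements_def smooth_on_affine)
  then obtain J \<theta>' where J: "(J, \<theta>') \<in> arbitrary_elements"
      "maps_to_class_member D \<Phi> I (\<lambda>x. a + (x - x0) *\<^sub>R b) J \<theta>'"
    using equivalence unfolding usual_equivalence_def preserves_class_def by blast
  show ?thesis
  proof (rule that[of J \<theta>'])
    show "smooth_on J \<theta>'" using J(1) by (simp add: arbitrary_elements_def)
  qed (use J(2)[unfolded maps_to_class_member_def] in \<open>metis prod.collapse\<close>)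
qed

lemma class_image_constant:
  assumes "coef a (CARD('r)) \<noteq> 0"
  obtains \<theta>' where
    "\<And>p. (p, a) \<in> D \<Longrightarrow> snd (\<Phi> (p, a)) = \<theta>' (xvar (fst (\<Phi> (p, a)))) \<and>
      (is_solved p a \<longleftrightarrow> is_solved (fst (\<Phi> (p, a))) (snd (\<Phi> (p, a))))"
proof (rule class_image[of UNIV a 0 0])
  fix J \<theta>'
  assume "\<And>p. xvar p \<in> UNIV \<Longrightarrow> (p, a + (xvar p - 0) *\<^sub>R 0) \<in> D \<Longrightarrow>
      xvar (fst (\<Phi> (p, a + (xvar p - 0) *\<^sub>R 0))) \<in> J \<and>
      snd (\<Phi> (p, a + (xvar p - 0) *\<^sub>R 0)) = \<theta>' (xvar (fst (\<Phi> (p, a + (xvar p - 0) *\<^sub>R 0)))) \<and>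
      (is_solved p (a + (xvar p - 0) *\<^sub>R 0) \<longleftrightarrow>
        is_solved (fst (\<Phi> (p, a + (xvar p - 0) *\<^sub>R 0))) (snd (\<Phi> (p, a + (xvar p - 0) *\<^sub>R 0))))"
  then show thesis using that[of \<theta>'] by simp
qed (use assms in \<open>auto simp: is_interval_univ\<close>)

lemma solved_iff:
  "(p, a) \<in> D \<Longrightarrow> coef a (CARD('r)) \<noteq> 0 \<Longrightarrow>
    is_solved p a \<longleftrightarrow> is_solved (fst (\<Phi> (p, a))) (snd (\<Phi> (p, a)))"
  using class_image_constant[of a] by metis

text \<open>The image of the constant tuple \<open>a\<close> is a function of the new x
  alone.\<close>

lemma snd_eq:
  assumes "(p, a) \<in> D" "(q, a) \<in> D" "coef a (CARD('r)) \<noteq> 0"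
    "xvar (fst (\<Phi> (p, a))) = xvar (fst (\<Phi> (q, a)))"
  shows "snd (\<Phi> (p, a)) = snd (\<Phi> (q, a))"
  using class_image_constant[of a] assms by metis

definition solved :: "'r joint set" where
  "solved = {(p, a). (p, a) \<in> D \<and> coef a (CARD('r)) \<noteq> 0 \<and> is_solved p a}"

lemma solvedD: "z \<in> solved \<Longrightarrow> z \<in> D"
  by (auto simp: solved_def)

text \<open>Since the new jet ignores \<open>a\<close>, it may be studied at a nearby value whose
  constant tuple belongs to the class.\<close>

lemma perturb_coef:
  assumes "(p, a) \<in> D"
  obtains a' where "(p, a') \<in> D" "coef a' (CARD('r)) \<noteq> 0"
proof -
  let ?b = "cvec (\<lambda>_. 1) 0 :: 'r arb"
  have "\<forall>\<^sub>F h in nhds 0. (p, a) + h *\<^sub>R (0, ?b) \<in> D"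
    by (rule eventually_line_in_open[OF open_D assms])
  then obtain h where "h \<noteq> 0" "(p, a + h *\<^sub>R ?b) \<in> D"
    by (rule eventually_nhds_0_nonzero) auto
  then show ?thesis
    using that[of a] that[of "a + h *\<^sub>R ?b"] assms by (cases "coef a (CARD('r)) = 0") auto
qed

text \<open>Reduces claims about the new (t, x, u) and their differentials to points on the
  equation, as by projectability these depend on (t, x, u) only.\<close>

lemma solved_over:
  assumes "z \<in> D"
  obtains w where "w \<in> solved" "jet_agree 0 (fst z) (fst w)"
proof -
  obtain p a where z: "z = (p, a)" by (cases z)
  obtain a' where "(p, a') \<in> D" "coef a' (CARD('r)) \<noteq> 0"
    using perturb_coef assms z by blast
  moreover from solved_lift[OF this(1)] obtain q where
    "(q, a') \<in> D" "jet_agree 0 p q" "is_solved q a'" by blast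
  ultimately show ?thesis
    using that[of "(q, a')"] by (simp add: z solved_def)
qed

section \<open>The new x depends on x only\<close>

text \<open>If the new x moved in the direction \<open>v\<close>, a combination \<open>w\<close> of
  \<open>v\<close> and \<open>ex\<close> would change x but, to first order, not the new x. Along an
  affine tuple the new arbitrary elements are a function of the new x, so they are stationary too,
  for every slope \<open>b\<close>. Two slopes then give a nonzero kernel vector of
  \<open>d\<Phi> z\<close>.\<close>

lemma xvar_dj_vertical_solved:
  assumes z: "z \<in> D" "coef (snd z) (CARD('r)) \<noteq> 0" and v: "xvar v = 0"
  shows "xvar (dj z v) = 0"
proof (rule ccontr)
  assume ne: "xvar (dj z v) \<noteq> 0"
  obtain p a where pa: "z = (p, a)" by (cases z)
  define w where "w = ex - (xvar (dj z ex) / xvar (dj z v)) *\<^sub>R v"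
  have w: "xvar w = 1" "xvar (dj z w) = 0"
    using ne v z by (simp_all add: w_def dj_simps)
  have key: "snd (d\<Phi> z (w, b)) = 0" for b
  proof -
    define x0 where "x0 = xvar p"
    \<comment> \<open>The leading coefficient is nonzero at \<open>x0\<close>, hence near
      \<open>x0\<close>; this provides the interval for the tuple.\<close>
    have "((\<lambda>x. coef a (CARD('r)) + (x - x0) * coef b (CARD('r))) \<longlongrightarrow>
        coef a (CARD('r)) + (x0 - x0) * coef b (CARD('r))) (nhds x0)"
      by (intro tendsto_intros filterlim_ident)
    from tendsto_imp_eventually_ne[OF this, of 0]
    have "\<forall>\<^sub>F x in nhds x0. coef (a + (x - x0) *\<^sub>R b) (CARD('r)) \<noteq> 0"
      using z(2) by (simp add: pa)
    then obtain e where e: "e > 0" "\<And>x. dist x x0 < e \<Longrightarrow> coef (a + (x - x0) *\<^sub>R b) (CARD('r)) \<noteq> 0"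
      by (auto simp: eventually_nhds_metric)
    obtain J \<theta>' where J: "smooth_on J \<theta>'"
      "\<And>p. xvar p \<in> ball x0 e \<Longrightarrow> (p, a + (xvar p - x0) *\<^sub>R b) \<in> D \<Longrightarrow>
        xvar (fst (\<Phi> (p, a + (xvar p - x0) *\<^sub>R b))) \<in> J \<and>
        snd (\<Phi> (p, a + (xvar p - x0) *\<^sub>R b)) = \<theta>' (xvar (fst (\<Phi> (p, a + (xvar p - x0) *\<^sub>R b))))"
      by (rule class_image[of "ball x0 e" a x0 b])
        (use e in \<open>auto simp: dist_commute is_interval_ball_real\<close>)
    have "xvar (fst (\<Phi> z)) \<in> J"
      using J(2)[of p] e z(1) by (simp add: x0_def pa)
    from smooth_on_has_derivative[OF J(1) this]
    have comp: "((\<lambda>w. \<theta>' (xvar (fst (\<Phi> w)))) has_derivative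
        (\<lambda>v. frechet_derivative \<theta>' (at (xvar (fst (\<Phi> z)))) (xvar (fst (d\<Phi> z v))))) (at z)"
      and lin: "linear (frechet_derivative \<theta>' (at (xvar (fst (\<Phi> z)))))"
      using has_derivative_compose[OF has_derivative_xvar[OF z(1)]] has_derivative_linear by blast+
    have "\<forall>\<^sub>F h in nhds 0. x0 + h *\<^sub>R 1 \<in> ball x0 e"
      by (rule eventually_line_in_open) (use e in auto)
    with eventually_line_in_open[OF open_D z(1), of "(w, b)"]
    have "\<forall>\<^sub>F h in nhds 0. snd (\<Phi> (z + h *\<^sub>R (w, b)))
        = \<theta>' (xvar (fst (\<Phi> (z + h *\<^sub>R (w, b))))) + 0"
    proof eventually_elim
      case (elim h)
      then show ?case
        using J(2)[of "p + h *\<^sub>R w"] e(1) w(1) by (simp add: pa x0_def)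
    qed
    then have "snd (d\<Phi> z (w, b))
        = frechet_derivative \<theta>' (at (xvar (fst (\<Phi> z)))) (xvar (fst (d\<Phi> z (w, b))))"
      by (rule directional_derivative_eq[OF has_derivative_snd[OF z(1)] comp])
    then show ?thesis
      using w z(1) lin by (simp add: fst_d\<Phi> linear_0)
  qed
  let ?b = "cvec (\<lambda>_. 0) 1 :: 'r arb"
  \<comment> \<open>The jet part of the differential is the same for the slopes \<open>?b\<close>
    and \<open>0\<close>, and the other part vanishes for both.\<close>
  have "d\<Phi> z (0, ?b) = d\<Phi> z (w, ?b) - d\<Phi> z (w, 0)"
    using linear_diff[OF linear_d\<Phi>[OF z(1)], of "(w, ?b)" "(w, 0)"] by simp
  also have "\<dots> = 0"
    using key[of ?b] key[of 0] z(1) by (simp add: prod_eq_iff fst_d\<Phi>)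
  also have "\<dots> = d\<Phi> z 0" using linear_0[OF linear_d\<Phi>[OF z(1)]] by simp
  finally have "(0 :: 'r jet, ?b) = 0"
    using inj_d\<Phi>[OF z(1)] by (simp add: inj_eq)
  then have "inhom ?b = 0" by (simp add: zero_prod_def inhom_def)
  then show False by simp
qed

text \<open>The difference \<open>v - xvar v *\<^sub>R ex\<close> does not move x. The condition on
  the leading coefficient is removed by passing to a nearby \<open>a'\<close>, which leaves the
  differential of the new x unchanged.\<close>

lemma xvar_dj:
  assumes "z \<in> D"
  shows "xvar (dj z v) = xvar (dj z ex) * xvar v"
proof -
  obtain p a where z: "z = (p, a)" by (cases z)
  obtain a' where a': "(p, a') \<in> D" "coef a' (CARD('r)) \<noteq> 0"
    using perturb_coef assms z by blast
  have "xvar (dj z u) = xvar (dj (p, a') u)" for u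
    using transfer[of 0 z "(p, a')" u u] assms a' by (simp add: z jet_agree_def)
  then have "xvar (dj z (v - xvar v *\<^sub>R ex)) = 0"
    using xvar_dj_vertical_solved[OF a'(1), of "v - xvar v *\<^sub>R ex"] a'(2) by simp
  then show ?thesis
    using assms by (simp add: dj_simps)
qed

lemma xvar_line_constant:
  assumes "z \<in> D" "xvar v = 0"
  shows "\<forall>\<^sub>F h in nhds 0. xvar (fst (\<Phi> (z + h *\<^sub>R (v, 0)))) = xvar (fst (\<Phi> z))"
proof -
  obtain e where e: "e > 0" "ball z e \<subseteq> D"
    using open_D assms(1) open_contains_ball by blast
  have "\<forall>\<^sub>F h in nhds 0. z + h *\<^sub>R (v, 0) \<in> ball z e"
    by (rule eventually_line_in_open) (use e in auto)
  then show ?thesis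
  proof eventually_elim
    case (elim h)
    show ?case
      by (rule constant_between[OF convex_ball has_derivative_xvar, of z e, symmetric])
        (use e elim assms in \<open>auto simp: fst_d\<Phi> dj_simps xvar_dj[of _ v] subset_iff\<close>)
  qed
qed

text \<open>Over \<open>p\<close> and \<open>q\<close> the arbitrary elements are transformed by the same local diffeomorphism. Its
  derivative takes the directions of the common hyperplane of \<open>p\<close> and \<open>q\<close> into the directions of the
  hyperplanes of both images, which therefore agree.\<close>

lemma same_hyperplane:
  assumes p: "(p, a) \<in> solved" and q: "(q, a) \<in> D"
    and X: "xvar (fst (\<Phi> (q, a))) = xvar (fst (\<Phi> (p, a)))"
    and eq: "der q 0 0 = der p 0 0" "\<forall>j\<in>{2..CARD('r)}. der q 0 j = der p 0 j" "lhs q = lhs p"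
  shows "j = 0 \<or> 2 \<le> j \<and> j \<le> CARD('r) \<Longrightarrow>
      der (fst (\<Phi> (q, a))) 0 j = der (fst (\<Phi> (p, a))) 0 j"
    and "lhs (fst (\<Phi> (q, a))) = lhs (fst (\<Phi> (p, a)))"
proof -
  have pD: "(p, a) \<in> D" and a: "coef a (CARD('r)) \<noteq> 0" and ps: "lhs p = rhs p a"
    using p by (auto simp: solved_def is_solved_iff)
  define h' where "h' = (\<lambda>b. snd (d\<Phi> (p, a) (0, b)))"
  define P where "P = fst (\<Phi> (p, a))"
  define Q where "Q = fst (\<Phi> (q, a))"
  have "linear h'"
    unfolding h'_def
    using linear_compose[OF linear_compose[OF _ linear_d\<Phi>[OF pD]] linear_snd, of "\<lambda>b. (0, b)"]
    by (simp add: o_def linear_iff)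
  moreover have "b = 0" if "h' b = 0" for b
  proof -
    have "d\<Phi> (p, a) (0, b) = d\<Phi> (p, a) 0"
      using that pD by (simp add: h'_def prod_eq_iff fst_d\<Phi> dj_simps linear_0[OF linear_d\<Phi>])
    then show ?thesis
      using inj_d\<Phi>[OF pD] by (simp add: inj_eq zero_prod_def)
  qed
  then have "inj h'"
    using \<open>linear h'\<close> by (simp add: linear_injective_0)
  ultimately have "surj h'"
    by (rule linear_inj_imp_surj)
  \<comment> \<open>If \<open>b\<close> is parallel to the hyperplane, the constant tuple
    \<open>a + h *\<^sub>R b\<close> satisfies the equation at both jets, so its common image
    satisfies both image equations for all small \<open>h\<close>. These are then differentiated in
    \<open>h\<close>.\<close>
  have tangent: "rhs P (h' b) = 0 \<and> rhs Q (h' b) = 0" if b: "rhs p b = 0" for b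
  proof -
    have "((\<lambda>h. coef a (CARD('r)) + h * coef b (CARD('r))) \<longlongrightarrow>
        coef a (CARD('r)) + 0 * coef b (CARD('r))) (nhds 0)"
      by (intro tendsto_intros filterlim_ident)
    from tendsto_imp_eventually_ne[OF this, of 0]
    have "\<forall>\<^sub>F h in nhds 0. coef (a + h *\<^sub>R b) (CARD('r)) \<noteq> 0"
      using a by simp
    with eventually_line_in_open[OF open_D pD, of "(0, b)"]
      eventually_line_in_open[OF open_D q, of "(0, b)"]
    have "\<forall>\<^sub>F h in nhds 0. rhs P (snd (\<Phi> ((p, a) + h *\<^sub>R (0, b)))) = lhs P \<and>
      rhs Q (snd (\<Phi> ((p, a) + h *\<^sub>R (0, b)))) = lhs Q"
    proof eventually_elim
      case (elim h)
      define a' where "a' = a + h *\<^sub>R b"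
      have mem: "(p, a') \<in> D" "(q, a') \<in> D" and nz: "coef a' (CARD('r)) \<noteq> 0"
        using elim by (auto simp: a'_def)
      have PQ: "fst (\<Phi> (p, a')) = P" "fst (\<Phi> (q, a')) = Q"
        unfolding P_def Q_def using mem pD q by (auto intro: fst_eq)
      have sp: "is_solved p a'"
        using b ps by (simp add: is_solved_iff a'_def rhs_add rhs_scale)
      then have sq: "is_solved q a'"
        using eq by (simp add: is_solved_iff rhs_cong[of q p])
      have "snd (\<Phi> (q, a')) = snd (\<Phi> (p, a'))"
        by (rule snd_eq[OF mem(2,1) nz]) (use X in \<open>simp add: PQ P_def Q_def\<close>)
      then show ?case
        using solved_iff[OF mem(1) nz] solved_iff[OF mem(2) nz] sp sq
        by (simp add: PQ is_solved_iff flip: a'_def)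
    qed
    then have *: "\<forall>\<^sub>F h in nhds 0. rhs P (snd (\<Phi> ((p, a) + h *\<^sub>R (0, b)))) = 0 + lhs P"
      "\<forall>\<^sub>F h in nhds 0. rhs Q (snd (\<Phi> ((p, a) + h *\<^sub>R (0, b)))) = 0 + lhs Q"
      by (simp_all add: eventually_conj_iff)
    have der: "((\<lambda>z. rhs R (snd (\<Phi> z))) has_derivative (\<lambda>v. rhs R (snd (d\<Phi> (p, a) v)))) (at (p, a))" for R
      by (rule bounded_linear.has_derivative[OF linear_rhs[unfolded linear_conv_bounded_linear]
            has_derivative_snd[OF pD]])
    show ?thesis
      using directional_derivative_eq[OF der has_derivative_const *(1)]
        directional_derivative_eq[OF der has_derivative_const *(2)]
      by (simp add: h'_def)
  qed
  let ?n = "cvec (\<lambda>_. 0) 1 :: 'r arb"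
  \<comment> \<open>A linear form vanishing on the kernel of \<open>rhs p\<close> is a multiple of
    it; the factor is the value at \<open>?n\<close>.\<close>
  have split: "rhs R (h' b) = rhs p b * rhs R (h' ?n)"
    if "R \<in> {P, Q}" for R b
  proof -
    have "rhs p (b - rhs p b *\<^sub>R ?n) = 0"
      by (simp add: rhs_diff rhs_scale rhs_cvec)
    from tangent[OF this] have "rhs R (h' (b - rhs p b *\<^sub>R ?n)) = 0"
      using that by auto
    then show ?thesis
      using \<open>linear h'\<close> by (simp add: linear_diff linear_scale rhs_diff rhs_scale)
  qed
  \<comment> \<open>Both \<open>rhs P\<close> and \<open>rhs Q\<close> take the value 1 at
    \<open>?n\<close>, which forces the two factors to coincide.\<close>
  obtain b0 where "h' b0 = ?n"
    using \<open>surj h'\<close> by (metis surjD)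
  then have "rhs p b0 * rhs P (h' ?n) = 1" "rhs p b0 * rhs Q (h' ?n) = 1"
    using split[of P b0] split[of Q b0] by (simp_all add: rhs_cvec)
  then have "rhs P (h' ?n) = rhs Q (h' ?n)"
    by (metis mult_cancel_left mult_zero_left zero_neq_one)
  then have "rhs P (h' b) = rhs Q (h' b)" for b
    using split[of P b] split[of Q b] by simp
  then have PQ: "rhs P b = rhs Q b" for b
    using \<open>surj h'\<close> by (metis surjD)
  show "der (fst (\<Phi> (q, a))) 0 j = der (fst (\<Phi> (p, a))) 0 j"
    if "j = 0 \<or> 2 \<le> j \<and> j \<le> CARD('r)"
    using PQ[of "cvec (\<lambda>i. of_bool (i = j)) 0"] that by (simp add: rhs_cvec P_def Q_def)
  have "is_solved p a" "is_solved q a"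
    using ps eq by (simp_all add: is_solved_iff rhs_cong[of q p])
  then have "lhs P = rhs P (snd (\<Phi> (p, a)))" "lhs Q = rhs Q (snd (\<Phi> (q, a)))"
    using solved_iff[OF pD a] solved_iff[OF q a] by (simp_all add: is_solved_iff P_def Q_def)
  moreover have "snd (\<Phi> (q, a)) = snd (\<Phi> (p, a))"
    by (rule snd_eq[OF q pD a X])
  ultimately show "lhs (fst (\<Phi> (q, a))) = lhs (fst (\<Phi> (p, a)))"
    using PQ by (simp add: P_def Q_def)
qed

section \<open>Directions along which the equation does not change\<close>

lemma hyperplane_line:
  assumes z: "z \<in> solved" and v: "xvar v = 0" "der v 0 0 = 0"
    "\<And>j. 2 \<le> j \<Longrightarrow> j \<le> CARD('r) \<Longrightarrow> der v 0 j = 0" "der v 1 0 + der (fst z) 0 0 * der v 0 1 = 0"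
  shows "\<forall>\<^sub>F h in nhds 0. z + h *\<^sub>R (v, 0) \<in> solved \<and>
    (\<forall>j. j = 0 \<or> 2 \<le> j \<and> j \<le> CARD('r) \<longrightarrow>
      der (fst (\<Phi> (z + h *\<^sub>R (v, 0)))) 0 j = der (fst (\<Phi> z)) 0 j) \<and>
    lhs (fst (\<Phi> (z + h *\<^sub>R (v, 0)))) = lhs (fst (\<Phi> z))"
  using eventually_line_in_open[OF open_D solvedD[OF z], of "(v, 0)"]
    xvar_line_constant[OF solvedD[OF z] v(1)]
proof eventually_elim
  case (elim h)
  obtain p a where pa: "z = (p, a)" by (cases z)
  let ?q = "p + h *\<^sub>R v"
  have "h * (der v 1 0 + der p 0 0 * der v 0 1) = 0"
    using v(4) by (simp add: pa)
  then have lhs: "lhs ?q = lhs p"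
    using v(2) by (simp add: lhs_def algebra_simps)
  have eq: "der ?q 0 0 = der p 0 0" "\<forall>j\<in>{2..CARD('r)}. der ?q 0 j = der p 0 j"
    using v(2,3) by auto
  have q: "(?q, a) \<in> D" "xvar (fst (\<Phi> (?q, a))) = xvar (fst (\<Phi> (p, a)))"
    using elim by (simp_all add: pa)
  have "(?q, a) \<in> solved"
    using z q lhs rhs_cong[OF eq, of a] by (simp add: solved_def is_solved_iff pa)
  then show ?case
    using same_hyperplane[OF z[unfolded pa] q eq lhs] by (simp add: pa)
qed

lemma hyperplane_step:
  assumes z: "z \<in> solved" and v: "xvar v = 0" "der v 0 0 = 0"
    "\<And>j. 2 \<le> j \<Longrightarrow> j \<le> CARD('r) \<Longrightarrow> der v 0 j = 0" "der v 1 0 + der (fst z) 0 0 * der v 0 1 = 0"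
  obtains h where "h \<noteq> 0" "z + h *\<^sub>R (v, 0) \<in> solved"
    "\<And>j. j = 0 \<or> 2 \<le> j \<and> j \<le> CARD('r) \<Longrightarrow>
      der (fst (\<Phi> (z + h *\<^sub>R (v, 0)))) 0 j = der (fst (\<Phi> z)) 0 j"
    "lhs (fst (\<Phi> (z + h *\<^sub>R (v, 0)))) = lhs (fst (\<Phi> z))"
  using eventually_nhds_0_nonzero[OF hyperplane_line[OF z v]] by metis

lemma der_dj_et:
  assumes "z \<in> D"
  shows "der (dj z et) 0 0 = 0"
proof -
  obtain w where w: "w \<in> solved" "jet_agree 0 (fst z) (fst w)"
    by (rule solved_over[OF assms])
  have "\<forall>\<^sub>F h in nhds 0. der (fst (\<Phi> (w + h *\<^sub>R (et, 0)))) 0 0 = 0 + der (fst (\<Phi> w)) 0 0"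
    using hyperplane_line[OF w(1), of et] by (auto elim: eventually_mono)
  from directional_derivative_eq[OF has_derivative_der[OF solvedD[OF w(1)]] has_derivative_const this]
  have "der (dj w et) 0 0 = 0" by (simp add: dj_def)
  then show ?thesis
    using transfer[OF _ assms solvedD[OF w(1)] w(2), of et et] by (simp add: jet_agree_def)
qed

section \<open>First partials and first prolongation\<close>

text \<open>Partial derivatives of the new t, x, u. Those of the new x by t and u and of the new u
  by t are absent because they vanish, by \<open>xvar_dj\<close> and
  \<open>der_dj_et\<close>.\<close>

definition Tt :: "'r joint \<Rightarrow> real" where "Tt z = tvar (dj z et)"
definition Tx :: "'r joint \<Rightarrow> real" where "Tx z = tvar (dj z ex)"
definition Tu :: "'r joint \<Rightarrow> real" where "Tu z = tvar (dj z (eu 0 0))"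
definition Xx :: "'r joint \<Rightarrow> real" where "Xx z = xvar (dj z ex)"
definition Ux :: "'r joint \<Rightarrow> real" where "Ux z = der (dj z ex) 0 0"
definition Uu :: "'r joint \<Rightarrow> real" where "Uu z = der (dj z (eu 0 0)) 0 0"

lemma dj_order_0:
  assumes "z \<in> D"
  shows "tvar (dj z v) = Tt z * tvar v + Tx z * xvar v + Tu z * der v 0 0"
    and "xvar (dj z v) = Xx z * xvar v"
    and "der (dj z v) 0 0 = Ux z * xvar v + Uu z * der v 0 0"
proof -
  have "jet_agree 0 (dj z v) (dj z (tvar v *\<^sub>R et + xvar v *\<^sub>R ex + der v 0 0 *\<^sub>R eu 0 0))"
    by (rule transfer) (use assms in \<open>auto simp: jet_agree_def\<close>)
  then show "tvar (dj z v) = Tt z * tvar v + Tx z * xvar v + Tu z * der v 0 0"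
    and "der (dj z v) 0 0 = Ux z * xvar v + Uu z * der v 0 0"
    using assms der_dj_et[OF assms]
    by (simp_all add: jet_agree_def dj_simps Tt_def Tx_def Tu_def Ux_def Uu_def)
  show "xvar (dj z v) = Xx z * xvar v"
    unfolding Xx_def by (rule xvar_dj[OF assms])
qed

lemma partials_transfer:
  assumes "z \<in> D" "w \<in> D" "jet_agree 0 (fst z) (fst w)"
  shows "Tt z = Tt w" "Tx z = Tx w" "Tu z = Tu w" "Xx z = Xx w" "Ux z = Ux w" "Uu z = Uu w"
  using transfer[OF _ assms, of et et] transfer[OF _ assms, of ex ex]
    transfer[OF _ assms, of "eu 0 0" "eu 0 0"]
  by (simp_all add: jet_agree_def Tt_def Tx_def Tu_def Xx_def Ux_def Uu_def)

text \<open>The differential of the jet is onto and triangular in (x, u, t): preimages of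
  \<open>ex\<close>, \<open>eu 0 0\<close> and \<open>et\<close>, taken in this order, expose one
  diagonal entry each.\<close>

lemma partials_nonzero:
  assumes "z \<in> D"
  shows "Xx z \<noteq> 0" "Uu z \<noteq> 0" "Tt z \<noteq> 0"
proof -
  have onto: "\<exists>v. dj z v = w" for w
  proof -
    obtain v where "(w, 0) = d\<Phi> z v"
      using surjD[OF surj_d\<Phi>[OF assms]] by blast
    then have "dj z (fst v) = w"
      using fst_d\<Phi>[OF assms, of v] by (metis fst_conv)
    then show ?thesis by blast
  qed
  obtain v where "dj z v = ex" using onto by blast
  then have "Xx z * xvar v = 1" using dj_order_0(2)[OF assms, of v] by simp
  then show X: "Xx z \<noteq> 0" by auto
  obtain v where v: "dj z v = eu 0 0" using onto by blast
  then have "xvar v = 0" using dj_order_0(2)[OF assms, of v] X by simp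
  then have "Uu z * der v 0 0 = 1" using dj_order_0(3)[OF assms, of v] v by simp
  then show U: "Uu z \<noteq> 0" by auto
  obtain v where v: "dj z v = et" using onto by blast
  then have "xvar v = 0" using dj_order_0(2)[OF assms, of v] X by simp
  moreover from this have "der v 0 0 = 0" using dj_order_0(3)[OF assms, of v] v U by simp
  ultimately have "Tt z * tvar v = 1" using dj_order_0(1)[OF assms, of v] v by simp
  then show "Tt z \<noteq> 0" by auto
qed

lemma prolongation_order_1:
  assumes "z \<in> D"
  shows "Ux z + Uu z * der (fst z) 0 1 =
      der (fst (\<Phi> z)) 1 0 * (Tx z + Tu z * der (fst z) 0 1) + der (fst (\<Phi> z)) 0 1 * Xx z"
    and "Uu z * der (fst z) 1 0 = der (fst (\<Phi> z)) 1 0 * (Tt z + Tu z * der (fst z) 1 0)"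
  using contact[OF assms _ contact_vector_total(2), of 0 0]
    contact[OF assms _ contact_vector_total(1), of 0 0] assms
  by (simp_all add: dj_order_0)

lemma has_derivative_coordinate:
  "((\<lambda>w :: 'r joint. der (fst w) i k) has_derivative (\<lambda>v. der (fst v) i k)) (at z)"
  by (intro bounded_linear.has_derivative[OF bounded_linear_der]
      bounded_linear.has_derivative[OF bounded_linear_fst] has_derivative_ident)

text \<open>Differentiates \<open>prolongation_order_1\<close> in directions that fix (t, x, u); the
  partials are constant along these, so only the first derivatives, old and new, vary.\<close>

lemma prolongation_order_1_deriv:
  assumes z: "z \<in> D" and v: "jet_agree 0 v 0"
  shows "der (dj z v) 1 0 * (Tx z + Tu z * der (fst z) 0 1)
      + der (fst (\<Phi> z)) 1 0 * Tu z * der v 0 1 + der (dj z v) 0 1 * Xx z = Uu z * der v 0 1"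
    and "der (dj z v) 1 0 * (Tt z + Tu z * der (fst z) 1 0)
      + der (fst (\<Phi> z)) 1 0 * Tu z * der v 1 0 = Uu z * der v 1 0"
proof -
  have part: "Tt (z + h *\<^sub>R (v, 0)) = Tt z" "Tx (z + h *\<^sub>R (v, 0)) = Tx z" "Tu (z + h *\<^sub>R (v, 0)) = Tu z"
    "Xx (z + h *\<^sub>R (v, 0)) = Xx z" "Ux (z + h *\<^sub>R (v, 0)) = Ux z" "Uu (z + h *\<^sub>R (v, 0)) = Uu z"
    if "z + h *\<^sub>R (v, 0) \<in> D" for h
    using partials_transfer[OF that z] v by (simp_all add: jet_agree_def)
  have ev: "\<forall>\<^sub>F h in nhds 0. z + h *\<^sub>R (v, 0) \<in> D"
    by (rule eventually_line_in_open[OF open_D z])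
  let ?q = "\<lambda>w. der (fst (\<Phi> w)) 1 0" and ?r = "\<lambda>w. der (fst (\<Phi> w)) 0 1"
  have d1: "((\<lambda>w. ?q w * (Tx z + Tu z * der (fst w) 0 1) + ?r w * Xx z - Uu z * der (fst w) 0 1)
      has_derivative (\<lambda>v. ?q z * (Tu z * der (fst v) 0 1)
        + der (fst (d\<Phi> z v)) 1 0 * (Tx z + Tu z * der (fst z) 0 1)
        + der (fst (d\<Phi> z v)) 0 1 * Xx z - Uu z * der (fst v) 0 1)) (at z)"
    by (rule derivative_eq_intros has_derivative_der[OF z] has_derivative_coordinate refl | simp)+
  have e1: "\<forall>\<^sub>F h in nhds 0. ?q (z + h *\<^sub>R (v, 0)) * (Tx z + Tu z * der (fst (z + h *\<^sub>R (v, 0))) 0 1)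
      + ?r (z + h *\<^sub>R (v, 0)) * Xx z - Uu z * der (fst (z + h *\<^sub>R (v, 0))) 0 1 = 0 + Ux z"
    using ev
  proof eventually_elim
    case (elim h)
    then show ?case using prolongation_order_1(1)[OF elim] unfolding part[OF elim] by linarith
  qed
  from directional_derivative_eq[OF d1 has_derivative_const e1]
  show "der (dj z v) 1 0 * (Tx z + Tu z * der (fst z) 0 1)
      + der (fst (\<Phi> z)) 1 0 * Tu z * der v 0 1 + der (dj z v) 0 1 * Xx z = Uu z * der v 0 1"
    by (simp add: dj_def algebra_simps)
  have d2: "((\<lambda>w. ?q w * (Tt z + Tu z * der (fst w) 1 0) - Uu z * der (fst w) 1 0)
      has_derivative (\<lambda>v. ?q z * (Tu z * der (fst v) 1 0)
        + der (fst (d\<Phi> z v)) 1 0 * (Tt z + Tu z * der (fst z) 1 0)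
        - Uu z * der (fst v) 1 0)) (at z)"
    by (rule derivative_eq_intros has_derivative_der[OF z] has_derivative_coordinate refl | simp)+
  have e2: "\<forall>\<^sub>F h in nhds 0. ?q (z + h *\<^sub>R (v, 0)) * (Tt z + Tu z * der (fst (z + h *\<^sub>R (v, 0))) 1 0)
      - Uu z * der (fst (z + h *\<^sub>R (v, 0))) 1 0 = 0 + 0"
    using ev
  proof eventually_elim
    case (elim h)
    then show ?case using prolongation_order_1(2)[OF elim] unfolding part[OF elim] by linarith
  qed
  from directional_derivative_eq[OF d2 has_derivative_const e2]
  show "der (dj z v) 1 0 * (Tt z + Tu z * der (fst z) 1 0)
      + der (fst (\<Phi> z)) 1 0 * Tu z * der v 1 0 = Uu z * der v 1 0"
    by (simp add: dj_def algebra_simps)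
qed

section \<open>The new t depends on t only\<close>

text \<open>A change of u_tx alone keeps the equation and hence the new u_xx. The changes of the
  total derivatives of the new u_x are then multiples of the unknown change of the new u_tx.
  Eliminating it relates the derivatives of the new u_x by u_t and u_x, as
  \<open>T_gradient_algebra\<close> requires.\<close>

lemma tvar_dj_Dx_solved:
  assumes z: "z \<in> solved"
  shows "Tx z + Tu z * der (fst z) 0 1 = 0"
proof -
  obtain h where h: "h \<noteq> 0" "z + h *\<^sub>R (eu 1 1, 0) \<in> solved"
    and eq: "\<And>j. j = 0 \<or> 2 \<le> j \<and> j \<le> CARD('r) \<Longrightarrow>
      der (fst (\<Phi> (z + h *\<^sub>R (eu 1 1, 0)))) 0 j = der (fst (\<Phi> z)) 0 j"
    by (rule hyperplane_step[OF z, of "eu 1 1"]) auto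
  define z' where "z' = z + h *\<^sub>R (eu 1 1, 0)"
  have D: "z \<in> D" "z' \<in> D" using z h by (auto simp: z'_def solvedD)
  have fst: "fst z' = fst z + h *\<^sub>R eu 1 1" by (simp add: z'_def)
  have ag: "jet_agree 1 (fst z') (fst z)" by (simp add: fst jet_agree_1)
  have part: "Tt z' = Tt z" "Tx z' = Tx z" "Tu z' = Tu z" "Xx z' = Xx z" "Ux z' = Ux z" "Uu z' = Uu z"
    using partials_transfer[OF D(2,1)] ag by (simp_all add: jet_agree_1 jet_agree_0)
  \<comment> \<open>As u_tx is the u_t-component of \<open>Dx\<close> and the u_x-component of
    \<open>Dt\<close>, these shift by multiples of \<open>eu 1 0\<close> and
    \<open>eu 0 1\<close>.\<close>
  have Dx': "jet_agree 1 (dj z' (Dx (fst z'))) (dj z (Dx (fst z) + h *\<^sub>R eu 1 0))"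
    by (rule transfer) (use D ag in \<open>simp_all add: fst jet_agree_1\<close>)
  have Dt': "jet_agree 1 (dj z' (Dt (fst z'))) (dj z (Dt (fst z) + h *\<^sub>R eu 0 1))"
    by (rule transfer) (use D ag in \<open>simp_all add: fst jet_agree_1\<close>)
  let ?xi = "Tx z + Tu z * der (fst z) 0 1" and ?tau = "Tt z + Tu z * der (fst z) 1 0"
  let ?q = "der (fst (\<Phi> z)) 1 1" and ?q' = "der (fst (\<Phi> z')) 1 1"
  \<comment> \<open>Order at least two is used here: u_x then has a contact form.\<close>
  have lt: "0 + 1 < CARD('r)" using order by linarith
  have Q02: "der (fst (\<Phi> z')) 0 (Suc 1) = der (fst (\<Phi> z)) 0 (Suc 1)"
    using eq[of 2] by (simp add: z'_def numeral_2_eq_2)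
  have "der (dj z (Dx (fst z))) 0 1 = ?q * ?xi + der (fst (\<Phi> z)) 0 (Suc 1) * Xx z"
    using contact[OF D(1) lt contact_vector_total(2)] D(1) by (simp add: dj_order_0)
  moreover have "der (dj z (Dx (fst z))) 0 1 + h * der (dj z (eu 1 0)) 0 1
      = ?q' * ?xi + der (fst (\<Phi> z)) 0 (Suc 1) * Xx z"
    using contact[OF D(2) lt contact_vector_total(2)] D Dx' Q02
    by (simp add: jet_agree_1 dj_order_0 part dj_simps fst)
  ultimately have C: "h * der (dj z (eu 1 0)) 0 1 = (?q' - ?q) * ?xi"
    by (simp add: algebra_simps)
  have "der (dj z (Dt (fst z))) 0 1 = ?q * ?tau"
    using contact[OF D(1) lt contact_vector_total(1)] D(1) by (simp add: dj_order_0)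
  moreover have "der (dj z (Dt (fst z))) 0 1 + h * der (dj z (eu 0 1)) 0 1 = ?q' * ?tau"
    using contact[OF D(2) lt contact_vector_total(1)] D Dt'
    by (simp add: jet_agree_1 dj_order_0 part dj_simps fst)
  ultimately have E: "h * der (dj z (eu 0 1)) 0 1 = (?q' - ?q) * ?tau"
    by (simp add: algebra_simps)
  have "h * (der (dj z (eu 1 0)) 0 1 * ?tau) = h * (der (dj z (eu 0 1)) 0 1 * ?xi)"
    using C E by algebra
  then have CE: "der (dj z (eu 1 0)) 0 1 * ?tau = der (dj z (eu 0 1)) 0 1 * ?xi"
    using h(1) by simp
  have "jet_agree 0 (eu 1 0 :: 'r jet) 0" "jet_agree 0 (eu 0 1 :: 'r jet) 0"
    by (simp_all add: jet_agree_0)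
  note d = prolongation_order_1_deriv[OF D(1) this(1)] prolongation_order_1_deriv[OF D(1) this(2)]
  show ?thesis
  proof (rule T_gradient_algebra[OF _ _ _ _ CE prolongation_order_1(2)[OF D(1)] refl])
    show "der (dj z (eu 1 0)) 1 0 * ?xi + der (dj z (eu 1 0)) 0 1 * Xx z = 0"
      and "der (dj z (eu 1 0)) 1 0 * ?tau + der (fst (\<Phi> z)) 1 0 * Tu z = Uu z"
      and "der (dj z (eu 0 1)) 1 0 * ?xi + der (fst (\<Phi> z)) 1 0 * Tu z
        + der (dj z (eu 0 1)) 0 1 * Xx z = Uu z"
      and "der (dj z (eu 0 1)) 1 0 * ?tau = 0"
      using d by simp_all
  qed (use partials_nonzero[OF D(1)] in auto)
qed

text \<open>The direction raises u_x at rate 1 and u_t at rate -u, which keeps u_t + u u_x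
  fixed.\<close>

lemma hyperplane_step_x:
  assumes z: "z \<in> solved"
  obtains h z' where "h \<noteq> 0" "z' \<in> solved" "fst z' = fst z + h *\<^sub>R (eu 0 1 - der (fst z) 0 0 *\<^sub>R eu 1 0)"
    "jet_agree 0 (fst z') (fst z)"
    "der (fst (\<Phi> z')) 0 0 = der (fst (\<Phi> z)) 0 0" "der (fst (\<Phi> z')) 0 2 = der (fst (\<Phi> z)) 0 2"
    "lhs (fst (\<Phi> z')) = lhs (fst (\<Phi> z))"
proof -
  let ?v = "eu 0 1 - der (fst z) 0 0 *\<^sub>R eu 1 0 :: 'r jet"
  obtain h where "h \<noteq> 0" "z + h *\<^sub>R (?v, 0) \<in> solved"
    "\<And>j. j = 0 \<or> 2 \<le> j \<and> j \<le> CARD('r) \<Longrightarrow>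
      der (fst (\<Phi> (z + h *\<^sub>R (?v, 0)))) 0 j = der (fst (\<Phi> z)) 0 j"
    "lhs (fst (\<Phi> (z + h *\<^sub>R (?v, 0)))) = lhs (fst (\<Phi> z))"
    by (rule hyperplane_step[OF z, of ?v]) auto
  then show ?thesis
    by (intro that[of h "z + h *\<^sub>R (?v, 0)"]) (auto simp: jet_agree_0)
qed

text \<open>The total derivative \<open>Tx + Tu * u_x\<close> vanishes for two values of u_x over
  the same (t, x, u).\<close>

lemma T_only_t:
  assumes "z \<in> D"
  shows "Tx z = 0" "Tu z = 0"
proof -
  obtain w where w: "w \<in> solved" "jet_agree 0 (fst z) (fst w)"
    by (rule solved_over[OF assms])
  obtain h w' where w': "h \<noteq> 0" "w' \<in> solved" "jet_agree 0 (fst w') (fst w)"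
    "fst w' = fst w + h *\<^sub>R (eu 0 1 - der (fst w) 0 0 *\<^sub>R eu 1 0)"
    by (rule hyperplane_step_x[OF w(1)])
  have "Tx w + Tu w * der (fst w) 0 1 = 0" "Tx w + Tu w * (der (fst w) 0 1 + h) = 0"
    using tvar_dj_Dx_solved[OF w(1)] tvar_dj_Dx_solved[OF w'(2)]
      partials_transfer[OF solvedD[OF w'(2)] solvedD[OF w(1)] w'(3)] by (simp_all add: w'(4))
  then have "Tu w * h = 0" by algebra
  then have "Tu w = 0" "Tx w = 0"
    using w'(1) \<open>Tx w + Tu w * der (fst w) 0 1 = 0\<close> by auto
  then show "Tx z = 0" "Tu z = 0"
    using partials_transfer[OF assms solvedD[OF w(1)] w(2)] by auto
qed

section \<open>The new u is proportional to u\<close>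

lemma prolongation_1:
  assumes "z \<in> D"
  shows "der (fst (\<Phi> z)) 0 1 * Xx z = Ux z + Uu z * der (fst z) 0 1"
    and "der (fst (\<Phi> z)) 1 0 * Tt z = Uu z * der (fst z) 1 0"
  using prolongation_order_1[OF assms] T_only_t[OF assms] by simp_all

text \<open>A step \<open>h\<close> of u_x at fixed u_t + u u_x changes the new u_x by
  \<open>Uu * h / Xx\<close> and the new u_t by \<open>- Uu * u * h / Tt\<close>. Since the new u_t
  + u u_x stays fixed, these balance with the new u as weight.\<close>

lemma U_linear:
  assumes "z \<in> D"
  shows "der (fst (\<Phi> z)) 0 0 * Tt z = Xx z * der (fst z) 0 0"
proof -
  obtain w where w: "w \<in> solved" "jet_agree 0 (fst z) (fst w)"
    by (rule solved_over[OF assms])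
  obtain h w' where w': "h \<noteq> 0" "w' \<in> solved"
    "fst w' = fst w + h *\<^sub>R (eu 0 1 - der (fst w) 0 0 *\<^sub>R eu 1 0)"
    "jet_agree 0 (fst w') (fst w)"
    "der (fst (\<Phi> w')) 0 0 = der (fst (\<Phi> w)) 0 0" "der (fst (\<Phi> w')) 0 2 = der (fst (\<Phi> w)) 0 2"
    "lhs (fst (\<Phi> w')) = lhs (fst (\<Phi> w))"
    by (rule hyperplane_step_x[OF w(1)])
  let ?U = "der (fst (\<Phi> w)) 0 0" and ?u = "der (fst w) 0 0"
  let ?dx = "der (fst (\<Phi> w')) 0 1 - der (fst (\<Phi> w)) 0 1"
    and ?dt = "der (fst (\<Phi> w')) 1 0 - der (fst (\<Phi> w)) 1 0"
  have D: "w \<in> D" "w' \<in> D" using w w' solvedD by auto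
  have "?dx * Xx w = Uu w * h" "?dt * Tt w = - Uu w * (?u * h)"
    using prolongation_1[OF D(1)] prolongation_1[OF D(2)] partials_transfer[OF D(2,1) w'(4)]
    by (simp_all add: w'(3) algebra_simps)
  moreover have "?dt + ?U * ?dx = 0"
    using w'(5,7) by (simp add: lhs_def algebra_simps)
  ultimately have "Uu w * h * (?U * Tt w - ?u * Xx w) = 0" by algebra
  then have "?U * Tt w = Xx w * ?u"
    using w'(1) partials_nonzero[OF D(1)] by simp
  then show ?thesis
    using projection[OF _ assms D(1) w(2)] w(2) partials_transfer[OF assms D(1) w(2)]
    by (simp add: jet_agree_0)
qed

section \<open>From local to global constancy\<close>

lemma ball_in_D:
  assumes "z \<in> D"
  obtains e where "e > 0" "ball z e \<subseteq> D"
  using open_D assms open_contains_ball by blast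

text \<open>\<open>D\<close> may fail to be convex, so the vanishing partials are integrated inside
  balls.\<close>

lemma constant_in_ball:
  assumes "ball z e \<subseteq> D" "w \<in> ball z e" "w' \<in> ball z e"
  shows "tvar (fst w) = tvar (fst w') \<Longrightarrow> tvar (fst (\<Phi> w)) = tvar (fst (\<Phi> w'))"
    and "xvar (fst w) = xvar (fst w') \<Longrightarrow> xvar (fst (\<Phi> w)) = xvar (fst (\<Phi> w'))"
    and "xvar (fst w) = xvar (fst w') \<Longrightarrow> der (fst w) 0 0 = der (fst w') 0 0 \<Longrightarrow>
      der (fst (\<Phi> w)) 0 0 = der (fst (\<Phi> w')) 0 0"
proof -
  have D: "y \<in> D" if "y \<in> ball z e" for y using assms that by auto
  show "tvar (fst (\<Phi> w)) = tvar (fst (\<Phi> w'))" if "tvar (fst w) = tvar (fst w')"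
    by (rule constant_between[OF convex_ball has_derivative_tvar[OF D] _ assms(2,3)])
      (use that D in \<open>simp_all add: fst_d\<Phi> dj_order_0 T_only_t\<close>)
  show "xvar (fst (\<Phi> w)) = xvar (fst (\<Phi> w'))" if "xvar (fst w) = xvar (fst w')"
    by (rule constant_between[OF convex_ball has_derivative_xvar[OF D] _ assms(2,3)])
      (use that D in \<open>simp_all add: fst_d\<Phi> dj_order_0\<close>)
  show "der (fst (\<Phi> w)) 0 0 = der (fst (\<Phi> w')) 0 0"
    if "xvar (fst w) = xvar (fst w')" "der (fst w) 0 0 = der (fst w') 0 0"
    by (rule constant_between[OF convex_ball has_derivative_der[OF D] _ assms(2,3)])
      (use that D in \<open>simp_all add: fst_d\<Phi> dj_order_0\<close>)
qed

text \<open>Inside the ball the new t, x, u are functions of t, of x and of (x, u) respectively, and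
  their derivatives inherit this.\<close>

lemma partials_in_ball:
  assumes "ball z e \<subseteq> D" "w \<in> ball z e" "w' \<in> ball z e"
  shows "tvar (fst w) = tvar (fst w') \<Longrightarrow> Tt w = Tt w'"
    and "xvar (fst w) = xvar (fst w') \<Longrightarrow> Xx w = Xx w'"
    and "xvar (fst w) = xvar (fst w') \<Longrightarrow> der (fst w) 0 0 = der (fst w') 0 0 \<Longrightarrow> Uu w = Uu w'"
proof -
  have D: "w \<in> D" "w' \<in> D" using assms by auto
  have ev: "\<forall>\<^sub>F h in nhds 0. w + h *\<^sub>R (v, 0) \<in> ball z e \<and> w' + h *\<^sub>R (v, 0) \<in> ball z e" for v
    by (intro eventually_conj eventually_line_in_open open_ball assms)
  show "Tt w = Tt w'" if "tvar (fst w) = tvar (fst w')"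
  proof -
    have "\<forall>\<^sub>F h in nhds 0. tvar (fst (\<Phi> (w + h *\<^sub>R (et, 0)))) = tvar (fst (\<Phi> (w' + h *\<^sub>R (et, 0)))) + 0"
      using ev[of et] by eventually_elim (use that constant_in_ball(1)[OF assms(1)] in auto)
    from directional_derivative_eq[OF has_derivative_tvar has_derivative_tvar this, OF D]
    show ?thesis by (simp add: Tt_def dj_def)
  qed
  show "Xx w = Xx w'" if "xvar (fst w) = xvar (fst w')"
  proof -
    have "\<forall>\<^sub>F h in nhds 0. xvar (fst (\<Phi> (w + h *\<^sub>R (ex, 0)))) = xvar (fst (\<Phi> (w' + h *\<^sub>R (ex, 0)))) + 0"
      using ev[of ex] by eventually_elim (use that constant_in_ball(2)[OF assms(1)] in auto)
    from directional_derivative_eq[OF has_derivative_xvar has_derivative_xvar this, OF D]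
    show ?thesis by (simp add: Xx_def dj_def)
  qed
  show "Uu w = Uu w'" if "xvar (fst w) = xvar (fst w')" "der (fst w) 0 0 = der (fst w') 0 0"
  proof -
    have "\<forall>\<^sub>F h in nhds 0. der (fst (\<Phi> (w + h *\<^sub>R (eu 0 0, 0)))) 0 0
        = der (fst (\<Phi> (w' + h *\<^sub>R (eu 0 0, 0)))) 0 0 + 0"
      using ev[of "eu 0 0"] by eventually_elim (use that constant_in_ball(3)[OF assms(1)] in auto)
    from directional_derivative_eq[OF has_derivative_der has_derivative_der this, OF D]
    show ?thesis by (simp add: Uu_def dj_def)
  qed
qed

text \<open>The derivative of \<open>U_linear\<close> by u, along which \<open>Tt\<close> and
  \<open>Xx\<close> do not vary.\<close>

lemma Uu_Tt:
  assumes z: "z \<in> D"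
  shows "Uu z * Tt z = Xx z"
proof -
  obtain e where e: "e > 0" "ball z e \<subseteq> D" by (rule ball_in_D[OF z])
  have "\<forall>\<^sub>F h in nhds 0. z + h *\<^sub>R (eu 0 0, 0) \<in> ball z e"
    by (rule eventually_line_in_open) (use e in auto)
  then have "\<forall>\<^sub>F h in nhds 0. der (fst (\<Phi> (z + h *\<^sub>R (eu 0 0, 0)))) 0 0 * Tt z
      - Xx z * der (fst (z + h *\<^sub>R (eu 0 0, 0))) 0 0 = 0 + 0"
  proof eventually_elim
    case (elim h)
    then have "Tt (z + h *\<^sub>R (eu 0 0, 0)) = Tt z" "Xx (z + h *\<^sub>R (eu 0 0, 0)) = Xx z"
      using partials_in_ball[OF e(2) elim, of z] e(1) by auto
    then show ?case
      using U_linear[OF subsetD[OF e(2) elim]] by simp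
  qed
  note ev = this
  have "((\<lambda>w. der (fst (\<Phi> w)) 0 0 * Tt z - Xx z * der (fst w) 0 0) has_derivative
      (\<lambda>v. der (fst (d\<Phi> z v)) 0 0 * Tt z - Xx z * der (fst v) 0 0)) (at z)"
    by (rule derivative_eq_intros has_derivative_der[OF z] has_derivative_coordinate refl | simp)+
  from directional_derivative_eq[OF this has_derivative_const ev] show ?thesis by (simp add: Uu_def dj_def)
qed

lemma constant_on_D:
  assumes "\<And>z e w. e > 0 \<Longrightarrow> ball z e \<subseteq> D \<Longrightarrow> w \<in> ball z e \<Longrightarrow> f w = f z"
    and "z \<in> D" "w \<in> D"
  shows "f z = f w"
proof (rule connected_local_const[OF connected_D assms(2,3)])
  show "\<forall>a\<in>D. \<forall>\<^sub>F b in at a within D. f a = f b"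
  proof
    fix a assume "a \<in> D"
    then obtain e where e: "e > 0" "ball a e \<subseteq> D" by (rule ball_in_D)
    then show "\<forall>\<^sub>F b in at a within D. f a = f b"
      unfolding eventually_at using assms(1)[OF e] by (metis mem_ball dist_commute)
  qed
qed

text \<open>Moving a single coordinate of \<open>z\<close> to its value at \<open>w\<close> leads no
  further from \<open>z\<close> than \<open>w\<close> itself.\<close>

lemma shift_in_ball:
  fixes z w :: "'r joint"
  assumes "e > 0" "w \<in> ball z e"
  shows "z + (tvar (fst w) - tvar (fst z)) *\<^sub>R (et, 0) \<in> ball z e"
    and "z + (xvar (fst w) - xvar (fst z)) *\<^sub>R (ex, 0) \<in> ball z e"
proof -
  have "norm (w - z) < e" using assms by (simp add: dist_norm norm_minus_commute)
  then show "z + (tvar (fst w) - tvar (fst z)) *\<^sub>R (et, 0) \<in> ball z e"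
    and "z + (xvar (fst w) - xvar (fst z)) *\<^sub>R (ex, 0) \<in> ball z e"
    using abs_tvar_le[of "w - z"] abs_xvar_le[of "w - z"]
    by (simp_all add: dist_norm del: scaleR_Pair)
qed

text \<open>Separation of variables: locally \<open>Tt\<close> depends on t only, while by
  \<open>Uu_Tt\<close> it is a quotient of functions of x and u. The point \<open>w0\<close> takes t
  from \<open>w\<close> and everything else from \<open>z\<close>.\<close>

lemma Tt_constant:
  assumes "z \<in> D" "w \<in> D"
  shows "Tt z = Tt w"
proof (rule constant_on_D[OF _ assms])
  fix z e w assume e: "e > 0" "ball z e \<subseteq> D" and w: "w \<in> ball z e"
  define w0 where "w0 = z + (tvar (fst w) - tvar (fst z)) *\<^sub>R (et, 0)"
  have w0: "w0 \<in> ball z e" unfolding w0_def by (rule shift_in_ball(1)[OF e(1) w])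
  have z: "z \<in> ball z e" using e by simp
  have D: "z \<in> D" "w0 \<in> D" using z w0 e by auto
  have "Uu w0 = Uu z" "Xx w0 = Xx z"
    using partials_in_ball(2,3)[OF e(2) w0 z] by (simp_all add: w0_def)
  then have "Tt w0 = Tt z"
    using Uu_Tt[OF D(1)] Uu_Tt[OF D(2)] partials_nonzero(2)[OF D(1)]
    by (metis mult_left_cancel)
  then show "Tt w = Tt z"
    using partials_in_ball(1)[OF e(2) w0 w] by (simp add: w0_def)
qed

section \<open>Vanishing of \<open>Ux\<close>\<close>

text \<open>Over fixed (t, x, u) the new u_x is affine in u_x with slope
  \<open>Uu / Xx = 1 / Tt\<close>, a global constant. Hence its values along the two parallel lines
  differ by a constant.\<close>

lemma der_dj_01_eq:
  assumes z: "z \<in> D" and w: "w \<in> D" and ag: "jet_agree 0 (fst z) (fst w)"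
  shows "der (dj z v) 0 1 = der (dj w v) 0 1"
proof -
  have "\<forall>\<^sub>F h in nhds 0. z + h *\<^sub>R (v, 0) \<in> D \<and> w + h *\<^sub>R (v, 0) \<in> D"
    by (intro eventually_conj eventually_line_in_open open_D z w)
  then have "\<forall>\<^sub>F h in nhds 0. der (fst (\<Phi> (z + h *\<^sub>R (v, 0)))) 0 1
      = der (fst (\<Phi> (w + h *\<^sub>R (v, 0)))) 0 1 + (der (fst z) 0 1 - der (fst w) 0 1) / Tt z"
  proof eventually_elim
    case (elim h)
    define z' where "z' = z + h *\<^sub>R (v, 0 :: 'r arb)"
    define w' where "w' = w + h *\<^sub>R (v, 0 :: 'r arb)"
    have D: "z' \<in> D" "w' \<in> D" using elim by (simp_all add: z'_def w'_def)
    have "jet_agree 0 (fst z') (fst w')"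
      using ag by (simp add: z'_def w'_def jet_agree_0)
    note part = partials_transfer[OF D this]
    have "Tt z' = Tt z" by (rule Tt_constant[OF D(1) z])
    have "(der (fst (\<Phi> z')) 0 1 - der (fst (\<Phi> w')) 0 1) * Xx z'
        = Uu z' * (der (fst z') 0 1 - der (fst w') 0 1)"
      using prolongation_1(1)[OF D(1)] prolongation_1(1)[OF D(2)]
      by (simp add: part algebra_simps)
    then have "Xx z' * ((der (fst (\<Phi> z')) 0 1 - der (fst (\<Phi> w')) 0 1) * Tt z')
        = Xx z' * (der (fst z') 0 1 - der (fst w') 0 1)"
      using Uu_Tt[OF D(1)] by algebra
    then have "(der (fst (\<Phi> z')) 0 1 - der (fst (\<Phi> w')) 0 1) * Tt z
        = der (fst z') 0 1 - der (fst w') 0 1"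
      using partials_nonzero(1)[OF D(1)] \<open>Tt z' = Tt z\<close> by simp
    then show ?case
      using partials_nonzero(3)[OF z] unfolding z'_def[symmetric] w'_def[symmetric]
      by (simp add: z'_def w'_def field_simps)
  qed
  from directional_derivative_eq[OF has_derivative_der[OF z] has_derivative_der[OF w] this]
  show ?thesis by (simp add: dj_def)
qed

text \<open>In the step of \<open>hyperplane_step_x\<close> the new u_xx, and with it the total
  x-derivative of the new u_x, stays the same, although \<open>Dx\<close> has moved by
  \<open>h\<close> in the direction of u.\<close>

lemma der_dj_01_eu:
  assumes "z \<in> D"
  shows "der (dj z (eu 0 0)) 0 1 = 0"
proof -
  obtain w where w: "w \<in> solved" "jet_agree 0 (fst z) (fst w)"
    by (rule solved_over[OF assms])
  obtain h w' where w': "h \<noteq> 0" "w' \<in> solved"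
    "fst w' = fst w + h *\<^sub>R (eu 0 1 - der (fst w) 0 0 *\<^sub>R eu 1 0)"
    "jet_agree 0 (fst w') (fst w)"
    "der (fst (\<Phi> w')) 0 0 = der (fst (\<Phi> w)) 0 0" "der (fst (\<Phi> w')) 0 2 = der (fst (\<Phi> w)) 0 2"
    "lhs (fst (\<Phi> w')) = lhs (fst (\<Phi> w))"
    by (rule hyperplane_step_x[OF w(1)])
  have D: "w \<in> D" "w' \<in> D" using w w' solvedD by auto
  have lt: "0 + 1 < CARD('r)" using order by linarith
  have Dx: "der (dj y (Dx (fst y))) 0 1 = der (fst (\<Phi> y)) 0 2 * Xx y" if "y \<in> D" for y
    using contact[OF that lt contact_vector_total(2)] T_only_t[OF that]
    by (simp add: dj_order_0[OF that] numeral_2_eq_2)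
  \<comment> \<open>Up to first order only the u-component of \<open>Dx\<close>, which is u_x,
    notices the step.\<close>
  have "jet_agree 1 (dj w (Dx (fst w'))) (dj w (Dx (fst w) + h *\<^sub>R eu 0 0))"
    by (rule transfer) (use D in \<open>simp_all add: w'(3) jet_agree_1\<close>)
  then have "der (dj w (Dx (fst w'))) 0 1 = der (dj w (Dx (fst w))) 0 1 + h * der (dj w (eu 0 0)) 0 1"
    using D by (simp add: jet_agree_1 dj_simps)
  moreover have "der (dj w (Dx (fst w'))) 0 1 = der (dj w' (Dx (fst w'))) 0 1"
    by (rule der_dj_01_eq[OF D(2,1) w'(4), symmetric])
  ultimately have "der (dj w (eu 0 0)) 0 1 = 0"
    using Dx[OF D(1)] Dx[OF D(2)] w'(1,6) partials_transfer(4)[OF D(2,1) w'(4)] by simp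
  then show ?thesis
    using der_dj_01_eq[OF assms D(1) w(2)] by simp
qed

text \<open>By \<open>der_dj_01_eu\<close> and the first prolongation, \<open>Ux\<close> does not
  vary with u. By \<open>U_linear\<close> the new u, and hence \<open>Ux\<close>, is proportional to
  u. Both together force zero.\<close>

lemma Ux_zero:
  assumes z: "z \<in> D"
  shows "Ux z = 0"
proof -
  obtain e where e: "e > 0" "ball z e \<subseteq> D" by (rule ball_in_D[OF z])
  have "\<forall>\<^sub>F h in nhds 0. z + h *\<^sub>R (eu 0 0, 0) \<in> ball z e"
    by (rule eventually_line_in_open) (use e in auto)
  then obtain s where s: "s \<noteq> 0" "z + s *\<^sub>R (eu 0 0, 0) \<in> ball z e"
    by (rule eventually_nhds_0_nonzero)
  define w where "w = z + s *\<^sub>R (eu 0 0, 0 :: 'r arb)"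
  have b: "w \<in> ball z e" "z \<in> ball z e" using s e by (auto simp: w_def)
  have w: "w \<in> D" using b e by auto
  have Xx: "Xx w = Xx z"
    by (rule partials_in_ball(2)[OF e(2) b]) (simp add: w_def)
  have "der (fst (\<Phi> z)) 0 1 - der (fst z) 0 1 * (1 / Tt z)
      = der (fst (\<Phi> w)) 0 1 - der (fst w) 0 1 * (1 / Tt z)"
  proof (rule constant_between[where C = "ball z e" and
        f' = "\<lambda>y v. der (fst (d\<Phi> y v)) 0 1 - der (fst v) 0 1 * (1 / Tt z)"])
    fix y assume "y \<in> ball z e"
    then have y: "y \<in> D" using e by auto
    show "((\<lambda>y. der (fst (\<Phi> y)) 0 1 - der (fst y) 0 1 * (1 / Tt z)) has_derivative
        (\<lambda>v. der (fst (d\<Phi> y v)) 0 1 - der (fst v) 0 1 * (1 / Tt z))) (at y)"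
      by (intro has_derivative_diff has_derivative_mult_left has_derivative_der[OF y]
          has_derivative_coordinate)
    show "der (fst (d\<Phi> y (w - z))) 0 1 - der (fst (w - z)) 0 1 * (1 / Tt z) = 0"
      using der_dj_01_eu[OF y] by (simp add: fst_d\<Phi>[OF y] w_def dj_simps[OF y])
  qed (use b in auto)
  then have "der (fst (\<Phi> w)) 0 1 = der (fst (\<Phi> z)) 0 1"
    by (simp add: w_def)
  moreover have "Uu w = Uu z"
    using Uu_Tt[OF z] Uu_Tt[OF w] Tt_constant[OF z w] Xx partials_nonzero(3)[OF w]
    by (metis mult_right_cancel)
  ultimately have Ux: "Ux w = Ux z"
    using prolongation_1(1)[OF z] prolongation_1(1)[OF w] by (simp add: Xx, simp add: w_def)
  let ?u = "der (fst z) 0 0"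
  have "\<forall>\<^sub>F h in nhds 0. w + h *\<^sub>R (ex, 0) \<in> ball z e \<and> z + h *\<^sub>R (ex, 0) \<in> ball z e"
    by (intro eventually_conj eventually_line_in_open open_ball b)
  \<comment> \<open>Proportionality of the new u at u and u + s, cross-multiplied because u may be
    zero.\<close>
  then have "\<forall>\<^sub>F h in nhds 0. ?u * der (fst (\<Phi> (w + h *\<^sub>R (ex, 0)))) 0 0
      = (?u + s) * der (fst (\<Phi> (z + h *\<^sub>R (ex, 0)))) 0 0 + 0"
  proof eventually_elim
    case (elim h)
    define z' where "z' = z + h *\<^sub>R (ex, 0 :: 'r arb)"
    define w' where "w' = w + h *\<^sub>R (ex, 0 :: 'r arb)"
    have b': "w' \<in> ball z e" "z' \<in> ball z e" using elim by (simp_all add: z'_def w'_def)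
    then have D: "w' \<in> D" "z' \<in> D" using e by auto
    have "Xx w' = Xx z'"
      by (rule partials_in_ball(2)[OF e(2) b']) (simp add: z'_def w'_def w_def)
    moreover have "Tt w' = Tt z'" by (rule Tt_constant[OF D])
    moreover have "der (fst w') 0 0 = ?u + s" "der (fst z') 0 0 = ?u"
      by (simp_all add: z'_def w'_def w_def)
    ultimately have lin: "der (fst (\<Phi> w')) 0 0 * Tt z' = Xx z' * (?u + s)"
      "der (fst (\<Phi> z')) 0 0 * Tt z' = Xx z' * ?u"
      using U_linear[OF D(1)] U_linear[OF D(2)] by simp_all
    have "Tt z' * (?u * der (fst (\<Phi> w')) 0 0) = ?u * (der (fst (\<Phi> w')) 0 0 * Tt z')" by simp
    also have "\<dots> = (?u + s) * (der (fst (\<Phi> z')) 0 0 * Tt z')" by (simp only: lin) simp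
    finally have "Tt z' * (?u * der (fst (\<Phi> w')) 0 0) = Tt z' * ((?u + s) * der (fst (\<Phi> z')) 0 0)"
      by simp
    then have "?u * der (fst (\<Phi> w')) 0 0 = (?u + s) * der (fst (\<Phi> z')) 0 0"
      using partials_nonzero(3)[OF D(2)] by simp
    then show ?case by (simp only: z'_def w'_def add_0_right)
  qed
  from directional_derivative_eq[OF has_derivative_mult_right[OF has_derivative_der[OF w]]
      has_derivative_mult_right[OF has_derivative_der[OF z]] this]
  have "?u * Ux w = (?u + s) * Ux z" by (simp add: Ux_def dj_def)
  then show ?thesis
    using Ux s(1) by (simp add: distrib_right)
qed

section \<open>Affine t and x, and the derivatives of all orders\<close>

text \<open>By \<open>Ux_zero\<close> the new u does not vary with x, so neither does
  \<open>Uu\<close>, nor \<open>Xx = Uu * Tt\<close>; but locally \<open>Xx\<close> depends on x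
  only. Here \<open>w0\<close> takes x from \<open>w\<close> and the rest from
  \<open>z\<close>.\<close>

lemma Xx_constant:
  assumes "z \<in> D" "w \<in> D"
  shows "Xx z = Xx w"
proof (rule constant_on_D[OF _ assms])
  fix z e w assume e: "e > 0" "ball z e \<subseteq> D" and w: "w \<in> ball z e"
  define w0 where "w0 = z + (xvar (fst w) - xvar (fst z)) *\<^sub>R (ex, 0)"
  have w0: "w0 \<in> ball z e" unfolding w0_def by (rule shift_in_ball(2)[OF e(1) w])
  have z: "z \<in> ball z e" using e by simp
  have D: "z \<in> D" "w0 \<in> D" using z w0 e by auto
  have "\<forall>\<^sub>F h in nhds 0. w0 + h *\<^sub>R (eu 0 0, 0) \<in> ball z e \<and> z + h *\<^sub>R (eu 0 0, 0) \<in> ball z e"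
    by (intro eventually_conj eventually_line_in_open open_ball w0 z)
  then have "\<forall>\<^sub>F h in nhds 0. der (fst (\<Phi> (w0 + h *\<^sub>R (eu 0 0, 0)))) 0 0
      = der (fst (\<Phi> (z + h *\<^sub>R (eu 0 0, 0)))) 0 0 + 0"
  proof eventually_elim
    case (elim h)
    have "der (fst (\<Phi> (w0 + h *\<^sub>R (eu 0 0, 0)))) 0 0 = der (fst (\<Phi> (z + h *\<^sub>R (eu 0 0, 0)))) 0 0"
    proof (rule constant_between[OF convex_ball has_derivative_der, of z e])
      show "der (fst (d\<Phi> y (z + h *\<^sub>R (eu 0 0, 0) - (w0 + h *\<^sub>R (eu 0 0, 0))))) 0 0 = 0"
        if "y \<in> ball z e" for y
        using that e(2) Ux_zero[of y]
        by (simp add: fst_d\<Phi> dj_order_0 subsetD[OF e(2) that] w0_def)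
    qed (use elim e(2) in auto)
    then show ?case by simp
  qed
  from directional_derivative_eq[OF has_derivative_der[OF D(2)] has_derivative_der[OF D(1)] this]
  have "Uu w0 = Uu z" by (simp add: Uu_def dj_def)
  then have "Xx w0 = Xx z"
    using Uu_Tt[OF D(1)] Uu_Tt[OF D(2)] Tt_constant[OF D] by simp
  then show "Xx w = Xx z"
    using partials_in_ball(2)[OF e(2) w0 w] by (simp add: w0_def)
qed

lemma tvar_affine:
  assumes "z \<in> D" "w \<in> D"
  shows "tvar (fst (\<Phi> w)) - Tt z * tvar (fst w) = tvar (fst (\<Phi> z)) - Tt z * tvar (fst z)"
proof (rule constant_on_D[OF _ assms(2,1)])
  fix y e x assume e: "e > 0" "ball y e \<subseteq> D" and x: "x \<in> ball y e"
  show "tvar (fst (\<Phi> x)) - Tt z * tvar (fst x) = tvar (fst (\<Phi> y)) - Tt z * tvar (fst y)"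
  proof (rule constant_between[where C = "ball y e" and
        f' = "\<lambda>w v. tvar (fst (d\<Phi> w v)) - Tt z * tvar (fst v)"])
    fix w assume "w \<in> ball y e"
    then have w: "w \<in> D" using e by auto
    show "((\<lambda>w. tvar (fst (\<Phi> w)) - Tt z * tvar (fst w)) has_derivative
        (\<lambda>v. tvar (fst (d\<Phi> w v)) - Tt z * tvar (fst v))) (at w)"
      by (intro has_derivative_diff has_derivative_mult_right has_derivative_tvar[OF w]
          bounded_linear.has_derivative[OF bounded_linear_tvar]
          bounded_linear.has_derivative[OF bounded_linear_fst] has_derivative_ident)
    show "tvar (fst (d\<Phi> w (y - x))) - Tt z * tvar (fst (y - x)) = 0"
      using T_only_t[OF w] Tt_constant[OF w assms(1)] by (simp add: fst_d\<Phi>[OF w] dj_order_0[OF w])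
  qed (use x e in auto)
qed

lemma xvar_affine:
  assumes "z \<in> D" "w \<in> D"
  shows "xvar (fst (\<Phi> w)) - Xx z * xvar (fst w) = xvar (fst (\<Phi> z)) - Xx z * xvar (fst z)"
proof (rule constant_on_D[OF _ assms(2,1)])
  fix y e x assume e: "e > 0" "ball y e \<subseteq> D" and x: "x \<in> ball y e"
  show "xvar (fst (\<Phi> x)) - Xx z * xvar (fst x) = xvar (fst (\<Phi> y)) - Xx z * xvar (fst y)"
  proof (rule constant_between[where C = "ball y e" and
        f' = "\<lambda>w v. xvar (fst (d\<Phi> w v)) - Xx z * xvar (fst v)"])
    fix w assume "w \<in> ball y e"
    then have w: "w \<in> D" using e by auto
    show "((\<lambda>w. xvar (fst (\<Phi> w)) - Xx z * xvar (fst w)) has_derivative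
        (\<lambda>v. xvar (fst (d\<Phi> w v)) - Xx z * xvar (fst v))) (at w)"
      by (intro has_derivative_diff has_derivative_mult_right has_derivative_xvar[OF w]
          bounded_linear.has_derivative[OF bounded_linear_xvar]
          bounded_linear.has_derivative[OF bounded_linear_fst] has_derivative_ident)
    show "xvar (fst (d\<Phi> w (y - x))) - Xx z * xvar (fst (y - x)) = 0"
      using Xx_constant[OF w assms(1)] by (simp add: fst_d\<Phi>[OF w] dj_order_0[OF w])
  qed (use x e in auto)
qed

lemma der_dj_scaled:
  assumes "z \<in> D" "\<And>w. w \<in> D \<Longrightarrow> der (fst (\<Phi> w)) i k = g * der (fst w) i k"
  shows "der (dj z v) i k = g * der v i k"
proof -
  have "\<forall>\<^sub>F h in nhds 0. der (fst (\<Phi> (z + h *\<^sub>R (v, 0)))) i k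
      = g * der (fst (z + h *\<^sub>R (v, 0))) i k + 0"
    using eventually_line_in_open[OF open_D assms(1), of "(v, 0)"]
    by eventually_elim (use assms(2) in simp)
  from directional_derivative_eq[OF has_derivative_der[OF assms(1)]
      has_derivative_mult_right[OF has_derivative_coordinate] this]
  show ?thesis by (simp add: dj_def)
qed

text \<open>Induction along x first and then along t: a new derivative that is a fixed multiple of
  the old one on all of \<open>D\<close> has total derivatives scaled in the same way, and
  \<open>contact\<close> divides these by \<open>Xx\<close> or \<open>Tt\<close>.\<close>

lemma prolongation:
  assumes z0: "z0 \<in> D"
  shows "z \<in> D \<Longrightarrow> i + k \<le> CARD('r) \<Longrightarrow>
    der (fst (\<Phi> z)) i k = (Xx z0 / Tt z0) / (Tt z0 ^ i * Xx z0 ^ k) * der (fst z) i k"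
proof (induction i arbitrary: k z)
  case 0
  then show ?case
  proof (induction k arbitrary: z)
    case 0
    then show ?case
      using U_linear[OF 0(1)] Tt_constant[OF 0(1) z0] Xx_constant[OF 0(1) z0] partials_nonzero(3)[OF z0]
      by (simp add: field_simps)
  next
    case (Suc k)
    let ?g = "(Xx z0 / Tt z0) / (Tt z0 ^ 0 * Xx z0 ^ k)"
    have lt: "0 + k < CARD('r)" using Suc.prems(2) by simp
    have "der (dj z (Dx (fst z))) 0 k = ?g * der (Dx (fst z)) 0 k"
      by (rule der_dj_scaled[OF Suc.prems(1)]) (use Suc in auto)
    moreover have "der (dj z (Dx (fst z))) 0 k = der (fst (\<Phi> z)) 0 (Suc k) * Xx z0"
      using contact[OF Suc.prems(1) lt contact_vector_total(2)] T_only_t[OF Suc.prems(1)]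
        Xx_constant[OF Suc.prems(1) z0]
      by (simp add: dj_order_0[OF Suc.prems(1)])
    ultimately show ?case
      using lt partials_nonzero[OF z0] by (simp add: field_simps)
  qed
next
  case (Suc i)
  let ?g = "(Xx z0 / Tt z0) / (Tt z0 ^ i * Xx z0 ^ k)"
  have lt: "i + k < CARD('r)" using Suc.prems(2) by simp
  have "der (dj z (Dt (fst z))) i k = ?g * der (Dt (fst z)) i k"
    by (rule der_dj_scaled[OF Suc.prems(1)]) (use Suc in auto)
  moreover have "der (dj z (Dt (fst z))) i k = der (fst (\<Phi> z)) (Suc i) k * Tt z0"
    using contact[OF Suc.prems(1) lt contact_vector_total(1)] T_only_t[OF Suc.prems(1)]
      Tt_constant[OF Suc.prems(1) z0]
    by (simp add: dj_order_0[OF Suc.prems(1)])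
  ultimately show ?case
    using lt partials_nonzero[OF z0] by (simp add: field_simps)
qed

lemma fst_equals_equiv_map:
  obtains c where "c \<in> params" "\<And>z. z \<in> D \<Longrightarrow> fst (\<Phi> z) = fst (equiv_map c z)"
proof -
  obtain z0 where z0: "z0 \<in> D" using nonempty_D by auto
  define c where "c = (Tt z0, tvar (fst (\<Phi> z0)) - Tt z0 * tvar (fst z0),
    Xx z0, xvar (fst (\<Phi> z0)) - Xx z0 * xvar (fst z0))"
  show ?thesis
  proof (rule that)
    show "c \<in> params" using partials_nonzero[OF z0] by (simp add: c_def params_def)
    fix z assume z: "z \<in> D"
    show "fst (\<Phi> z) = fst (equiv_map c z)"
      using tvar_affine[OF z0 z] xvar_affine[OF z0 z] prolongation[OF z0 z]
      by (intro jet_eqI) (simp add: jet_agree_def c_def equiv_map_simps)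
  qed
qed

section \<open>The components for the arbitrary elements\<close>

text \<open>Both candidates \<open>b\<close> and \<open>b'\<close> stay the same for all jets in
  \<open>D\<close> over the given x and \<open>a\<close>, and both satisfy the image equation of
  every such jet on the equation. Varying one u_j at a time compares their coefficients.\<close>

lemma snd_equals_equiv_map:
  assumes c: "(c1, c2, c3, c4) \<in> params"
    and jets: "\<And>z. z \<in> D \<Longrightarrow> fst (\<Phi> z) = fst (equiv_map (c1, c2, c3, c4) z)"
    and z: "(p, a) \<in> D" and a: "coef a (CARD('r)) \<noteq> 0"
  shows "snd (\<Phi> (p, a)) = snd (equiv_map (c1, c2, c3, c4) (p, a))"
proof -
  let ?E = "equiv_map (c1, c2, c3, c4) :: 'r joint \<Rightarrow> 'r joint"
  have c0: "c1 \<noteq> 0" "c3 \<noteq> 0" using c by (auto simp: params_def)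
  obtain q where q: "(q, a) \<in> D" "jet_agree 0 p q" "is_solved q a"
    using solved_lift[OF z] by blast
  define b where "b = snd (\<Phi> (p, a))"
  define b' where "b' = snd (?E (p, a))"
  have E: "snd (?E (q', a)) = b'" for q'
    unfolding b'_def by (rule arb_eqI) (simp_all add: equiv_map_simps)
  have key: "rhs (fst (?E (q', a))) b = rhs (fst (?E (q', a))) b'"
    if q': "(q', a) \<in> D" "xvar q' = xvar q" "is_solved q' a" for q'
  proof -
    have "snd (\<Phi> (q', a)) = b"
      unfolding b_def using q'(2) q(2)
      by (intro snd_eq[OF q'(1) z a]) (simp add: jets[OF q'(1)] jets[OF z] equiv_map_simps jet_agree_0)
    then have "is_solved (fst (?E (q', a))) b"
      using solved_iff[OF q'(1) a] q'(3) by (simp add: jets[OF q'(1)])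
    moreover have "is_solved (fst (?E (q', a))) b'"
      using is_solved_equiv_map[OF order c0, of c2 c4 q' a "fst (?E (q', a))" b'] q'(3) E[of q']
      by (metis prod.collapse)
    ultimately show ?thesis by (simp add: is_solved_iff)
  qed
  have coef: "coef b j = coef b' j" if j: "j = 0 \<or> 2 \<le> j \<and> j \<le> CARD('r)" for j
  proof -
    \<comment> \<open>Moves u_j and corrects u_t so that the equation stays satisfied. For
      \<open>j = 0\<close> the term u u_x also changes, at rate u_x, which is subtracted.\<close>
    define v where "v = (eu 0 j + (coef a j - (if j = 0 then der q 0 1 else 0)) *\<^sub>R eu 1 0 :: 'r jet)"
    obtain h where h: "h \<noteq> 0" "(q, a) + h *\<^sub>R (v, 0) \<in> D"
      by (rule eventually_nhds_0_nonzero[OF eventually_line_in_open[OF open_D q(1)]])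
    define q' where "q' = q + h *\<^sub>R v"
    have q': "(q', a) \<in> D" "xvar q' = xvar q" using h(2) j by (simp_all add: q'_def v_def)
    have d: "der q' 0 i = der q 0 i + h * of_bool (i = j)"
      if "i = 0 \<or> 2 \<le> i \<and> i \<le> CARD('r)" for i
      using that by (auto simp: q'_def v_def)
    have "rhs q' a = rhs q a + coef a j * h"
      by (rule rhs_shift[OF j d])
    moreover have "lhs q' = lhs q + coef a j * h"
      using j by (auto simp: lhs_def q'_def v_def algebra_simps)
    ultimately have s: "is_solved q' a"
      using q(3) by (simp add: is_solved_iff)
    \<comment> \<open>The resulting nonzero change of the new u_j.\<close>
    let ?s = "(c3 / c1) / c3 ^ j * h"
    have d': "der (fst (?E (q', a))) 0 i = der (fst (?E (q, a))) 0 i + ?s * of_bool (i = j)"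
      if "i = 0 \<or> 2 \<le> i \<and> i \<le> CARD('r)" for i
      using d[OF that] that by (auto simp: equiv_map_simps add_divide_distrib distrib_left)
    have "coef b j * ?s = coef b' j * ?s"
      using key[OF q' s] key[OF q(1) refl q(3)] rhs_shift[OF j d', of b] rhs_shift[OF j d', of b']
      by linarith
    then show ?thesis
      using c0 h(1) by simp
  qed
  \<comment> \<open>With all coefficients equal, a single jet on the equation fixes B.\<close>
  moreover have "inhom b = inhom b'"
    using key[OF q(1) refl q(3)] coef by (simp add: rhs_def)
  ultimately show ?thesis
    unfolding b_def[symmetric] b'_def[symmetric] by (intro arb_eqI)
qed

lemma equals_equiv_map:
  obtains c where "c \<in> params" "\<And>z. z \<in> D \<Longrightarrow> \<Phi> z = equiv_map c z"
proof -
  obtain c1 c2 c3 c4 where c: "(c1, c2, c3, c4) \<in> params"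
    and jets: "\<And>z. z \<in> D \<Longrightarrow> fst (\<Phi> z) = fst (equiv_map (c1, c2, c3, c4) z)"
    by (metis fst_equals_equiv_map prod.exhaust)
  let ?E = "equiv_map (c1, c2, c3, c4) :: 'r joint \<Rightarrow> 'r joint"
  have regular: "\<Phi> y = ?E y" if "y \<in> D" "coef (snd y) (CARD('r)) \<noteq> 0" for y
    using snd_equals_equiv_map[OF c jets, of "fst y" "snd y"] jets[OF that(1)] that
    by (simp add: prod_eq_iff)
  have "\<Phi> z = ?E z" if z: "z \<in> D" for z
  proof (cases "coef (snd z) (CARD('r)) = 0")
    case False
    then show ?thesis using regular z by simp
  next
    case True
    \<comment> \<open>In this direction the leading coefficient becomes nonzero for every
      \<open>h \<noteq> 0\<close>; both maps are continuous, so they agree in the limit.\<close>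
    let ?v = "(0, cvec (\<lambda>_. 1) 0) :: 'r joint"
    have "((\<lambda>h. z + h *\<^sub>R ?v) \<longlongrightarrow> z + 0 *\<^sub>R ?v) (at 0)"
      by (intro tendsto_intros)
    then have line: "((\<lambda>h. z + h *\<^sub>R ?v) \<longlongrightarrow> z) (at 0)" by (simp add: zero_prod_def[symmetric])
    have lim: "((\<lambda>h. \<Phi> (z + h *\<^sub>R ?v)) \<longlongrightarrow> \<Phi> z) (at 0)"
      by (rule isCont_tendsto_compose[OF has_derivative_continuous[OF has_derivative_\<Phi>[OF z]] line])
    have E: "((\<lambda>h. ?E (z + h *\<^sub>R ?v)) \<longlongrightarrow> ?E z) (at 0)"
      by (rule isCont_tendsto_compose[OF has_derivative_continuous[OF has_derivative_equiv_map] line])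
    have "\<forall>\<^sub>F h in at 0. \<Phi> (z + h *\<^sub>R ?v) = ?E (z + h *\<^sub>R ?v)"
      unfolding eventually_at_filter
      using eventually_line_in_open[OF open_D z, of ?v]
    proof eventually_elim
      case (elim h)
      show ?case
        using regular[OF elim] True by simp
    qed
    from tendsto_cong[OF this] E have lim': "((\<lambda>h. \<Phi> (z + h *\<^sub>R ?v)) \<longlongrightarrow> ?E z) (at 0)"
      by (rule iffD2)
    show ?thesis
      by (rule tendsto_unique[OF trivial_limit_at lim lim'])
  qed
  then show ?thesis using that[OF c] by blast
qed

end

section \<open>The equivalence group\<close>

theorem proposition9:
  assumes "CARD('r::finite) \<ge> 2"
  shows "(usual_equivalence_group :: ('r joint set \<times> ('r joint \<Rightarrow> 'r joint)) set) =
           {(D, restrict (equiv_map c) D) | D c. D \<in> transformation_domains \<and> c \<in> params} \<and>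
         lie_transformation_group 4 params
           (equiv_map :: real \<times> real \<times> real \<times> real \<Rightarrow> 'r joint \<Rightarrow> 'r joint)"
proof
  show "(usual_equivalence_group :: ('r joint set \<times> ('r joint \<Rightarrow> 'r joint)) set) =
      {(D, restrict (equiv_map c) D) | D c. D \<in> transformation_domains \<and> c \<in> params}"
  proof (intro equalityI subsetI)
    fix g :: "'r joint set \<times> ('r joint \<Rightarrow> 'r joint)"
    assume "g \<in> usual_equivalence_group"
    then obtain D \<Phi> where g: "g = (D, \<Phi>)" "usual_equivalence D \<Phi>" "\<Phi> \<in> extensional D"
      by (auto simp: usual_equivalence_group_def)
    interpret usual_equivalence_transformation D \<Phi>
      by unfold_locales (use assms g in auto)
    obtain c where c: "c \<in> params" "\<And>z. z \<in> D \<Longrightarrow> \<Phi> z = equiv_map c z"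
      using equals_equiv_map by blast
    \<comment> \<open>Outside \<open>D\<close> both maps take the default value of
      \<open>extensional\<close>, so agreement on \<open>D\<close> is equality.\<close>
    then have "\<Phi> = restrict (equiv_map c) D"
      using g(3) by (intro extensionalityI) auto
    then show "g \<in> {(D, restrict (equiv_map c) D) | D c. D \<in> transformation_domains \<and> c \<in> params}"
      using g(1,2) c(1) unfolding usual_equivalence_def by blast
  next
    fix g :: "'r joint set \<times> ('r joint \<Rightarrow> 'r joint)"
    assume "g \<in> {(D, restrict (equiv_map c) D) | D c. D \<in> transformation_domains \<and> c \<in> params}"
    then obtain D c where "g = (D, restrict (equiv_map c) D)" "D \<in> transformation_domains" "c \<in> params"
      by blast
    then show "g \<in> usual_equivalence_group"
      using usual_equivalence_equiv_map[OF assms] by (simp add: usual_equivalence_group_def)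
  qed
qed (rule lie_transformation_group_equiv_map)

end
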